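(* Let $\{ s_{m,n} \}_{m\in \mathbb{Z}_+,\, n\in \mathbb{Z}}$ be a given sequence of complex numbers. The Devinatz moment problem $$\int_\Pi x^m e^{in\varphi}\, d\mu = s_{m,n},\qquad m\in \mathbb{Z}_+,\ n\in \mathbb{Z},$$ has a solution $\mu$ (a non-negative Borel measure on $\Pi$) if and only if $$\sum_{m,k=0}^\infty\ \sum_{n,l=-\infty}^\infty \alpha_{m,n}\overline{\alpha_{k,l}}\, s_{m+k,n-l} \geq 0$$ for arbitrary complex numbers $\alpha_{m,n}$ ($m\in\mathbb{Z}_+$, $n\in\mathbb{Z}$) all but finitely many of which are zero.
   Context: $\mathbb{Z}_+$ is the set of non-negative integers. $\Pi = \{ (x,\varphi):\ x\in \mathbb{R},\ -\pi\leq \varphi < \pi \}$. The Devinatz moment problem for a sequence $\{s_{m,n}\}$ is to find a non-negative Borel measure $\mu$ on $\Pi$ (with all the integrals below absolutely convergent) such that $\int_\Pi x^m e^{in\varphi} d\mu = s_{m,n}$ for all $m\in\mathbb{Z}_+$, $n\in\mathbb{Z}$; such a $\mu$ is called a solution. *)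

theory Defs
  imports "HOL-Analysis.Analysis" "HOL-Library.Complex_Order"
begin

definition strip :: "(real \<times> real) set" where
  "strip = {(x, \<phi>). - pi \<le> \<phi> \<and> \<phi> < pi}"

definition devinatz_solution :: "(nat \<Rightarrow> int \<Rightarrow> complex) \<Rightarrow> (real \<times> real) measure \<Rightarrow> bool" where
  "devinatz_solution s \<mu> \<longleftrightarrow>
     sets \<mu> = sets (restrict_space borel strip) \<and>
     (\<forall>m n. integrable \<mu> (\<lambda>(x, \<phi>). complex_of_real x ^ m * exp (\<i> * of_int n * complex_of_real \<phi>)) \<and>
            (LINT (x, \<phi>)|\<mu>. complex_of_real x ^ m * exp (\<i> * of_int n * complex_of_real \<phi>)) = s m n)"

text \<open>The sum ranges over the support of \<open>\<alpha>\<close>, where alone the summands can be nonzero.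
  The order is the partial order on the complex numbers, so that \<open>0 \<le> z\<close> says that
  \<open>z\<close> is real and nonnegative.\<close>

definition devinatz_positive :: "(nat \<Rightarrow> int \<Rightarrow> complex) \<Rightarrow> bool" where
  "devinatz_positive s \<longleftrightarrow>
     (\<forall>\<alpha> :: nat \<Rightarrow> int \<Rightarrow> complex. finite {(m, n). \<alpha> m n \<noteq> 0} \<longrightarrow>
        0 \<le> (\<Sum>(m, n) \<in> {(m, n). \<alpha> m n \<noteq> 0}. \<Sum>(k, l) \<in> {(k, l). \<alpha> k l \<noteq> 0}.
               \<alpha> m n * cnj (\<alpha> k l) * s (m + k) (n - l)))"

end

theory Submission
  imports Defs "HOL-Probability.Probability" "HOL-Real_Asymp.Real_Asymp"
    "HOL-Computational_Algebra.Fundamental_Theorem_Algebra"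
begin

text \<open>
  Necessity is the identity
  \<open>\<Sum> \<alpha>\<^sub>m\<^sub>n cnj \<alpha>\<^sub>k\<^sub>l s\<^bsub>m+k,n-l\<^esub> = \<integral> |\<Sum> \<alpha>\<^sub>m\<^sub>n x\<^sup>m e\<^bsup>in\<phi>\<^esup>|\<^sup>2 d\<mu>\<close>.  Sufficiency is usually derived
  from the theory of commuting unitary and symmetric operators; the proof below only uses finite
  quadrature rules and a compactness argument.

  Fix a degree bound \<open>N\<close> and an angle \<open>\<phi>\<close>.  Testing positivity on \<open>p(x) \<Sum>\<^bsub>n\<le>N\<^esub> e\<^bsup>-in\<phi>\<^esup> z\<^sup>n\<close> with real
  polynomials \<open>p\<close> shows that \<open>h\<^sub>m = \<Sum>\<^bsub>n,l\<le>N\<^esub> s\<^bsub>m,n-l\<^esub> e\<^bsup>-i(n-l)\<phi>\<^esup>\<close> is a real sequence with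
  nonnegative Hankel form.  Gauss quadrature (\<open>gauss_quadrature\<close>) gives finitely many points of the line
  with nonnegative weights whose moments up to order \<open>N\<close> are the \<open>h\<^sub>m\<close>.  Putting these point masses at
  the angle \<open>\<phi>\<close>, dividing by \<open>N + 1\<close> and averaging over the angles \<open>\<phi> = 2\<pi>r/(2N+1)\<close> isolates the Fourier coefficients, as in
  Fejer's theorem: the resulting finite atomic measure has the moments
  \<open>(1 - |k|/(N+1)) s\<^bsub>m,k\<^esub>\<close> for \<open>m, |k| \<le> N\<close> (\<open>fejer_atomic_measures\<close>).

  As \<open>N\<close> grows these moments tend to \<open>s\<^bsub>m,k\<^esub>\<close>, and a limit point of the measures solves the problem.
  To obtain one from Helly's selection theorem on the line, the atoms are lifted along a continuous
  curve, defined on the line, that passes through all points of the strip and whose first coordinate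
  stays within bounded distance of the parameter (\<open>space_filling_curve\<close>).  The lifted
  measures are tight because their second moments in \<open>x\<close> are bounded; the moments survive in the weak
  limit because the even moments of higher order are bounded too (\<open>moments_of_weak_limit\<close>).  The image
  of the limit measure on the strip is a solution.
\<close>

section \<open>Gauss quadrature for positive Hankel sequences\<close>

definition moment_functional :: "(nat \<Rightarrow> real) \<Rightarrow> real poly \<Rightarrow> real" where
  "moment_functional h p = (\<Sum>i\<le>degree p. coeff p i * h i)"

lemma moment_functional_eq_sum:
  assumes "degree p \<le> n"
  shows "moment_functional h p = (\<Sum>i\<le>n. coeff p i * h i)"
  unfolding moment_functional_def
  by (rule sum.mono_neutral_left) (use assms in \<open>auto simp: coeff_eq_0\<close>)

lemma moment_functional_add:
  "moment_functional h (p + q) = moment_functional h p + moment_functional h q"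
proof -
  let ?n = "max (degree p) (degree q)"
  have "degree (p + q) \<le> ?n" by (rule degree_add_le_max)
  then show ?thesis
    using moment_functional_eq_sum[of p ?n h] moment_functional_eq_sum[of q ?n h]
      moment_functional_eq_sum[of "p + q" ?n h]
    by (simp add: sum.distrib algebra_simps)
qed

lemma moment_functional_smult: "moment_functional h (smult c p) = c * moment_functional h p"
  using moment_functional_eq_sum[of "smult c p" "degree p" h]
  by (simp add: degree_smult_le moment_functional_def sum_distrib_left mult.assoc)

lemma moment_functional_0: "moment_functional h 0 = 0"
  by (simp add: moment_functional_def)

lemma moment_functional_diff:
  "moment_functional h (p - q) = moment_functional h p - moment_functional h q"
  using moment_functional_add[of h p "smult (-1) q"] moment_functional_smult[of h "-1" q] by simp

lemma moment_functional_sum: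
  "moment_functional h (\<Sum>x\<in>A. f x) = (\<Sum>x\<in>A. moment_functional h (f x))"
  by (induction A rule: infinite_finite_induct)
     (auto simp: moment_functional_0 moment_functional_add)

lemma moment_functional_monom: "moment_functional h (monom c m) = c * h m"
proof -
  have "moment_functional h (monom c m) = (\<Sum>i\<le>m. coeff (monom c m) i * h i)"
    by (intro moment_functional_eq_sum degree_monom_le)
  also have "\<dots> = (\<Sum>i\<le>m. if i = m then c * h m else 0)"
    by (intro sum.cong) auto
  finally show ?thesis by simp
qed

text \<open>On a product the functional is the Hankel bilinear form of the coefficients, which is
  what connects it with the positivity hypothesis.\<close>

lemma moment_functional_mult:
  "moment_functional h (p * q) = (\<Sum>i\<le>degree p. \<Sum>j\<le>degree q. coeff p i * coeff q j * h (i + j))"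
proof -
  have "p * q = (\<Sum>i\<le>degree p. monom (coeff p i) i) * (\<Sum>j\<le>degree q. monom (coeff q j) j)"
    by (simp add: poly_as_sum_of_monoms)
  also have "\<dots> = (\<Sum>i\<le>degree p. \<Sum>j\<le>degree q. monom (coeff p i * coeff q j) (i + j))"
    by (simp add: sum_product mult_monom)
  finally show ?thesis
    by (simp add: moment_functional_sum moment_functional_monom)
qed

lemmas moment_functional_linear = moment_functional_add moment_functional_diff
  moment_functional_smult moment_functional_0

definition hankel_positive :: "(nat \<Rightarrow> real) \<Rightarrow> bool" where
  "hankel_positive h \<longleftrightarrow> (\<forall>p. 0 \<le> moment_functional h (p * p))"

text \<open>The Cauchy-Schwarz inequality in its degenerate case: otherwise the quadratic form would be
  affine and nonconstant, hence negative somewhere, along the line \<open>q + t p\<close>.\<close>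

lemma null_polynomial_orthogonal:
  assumes "hankel_positive h" "moment_functional h (p * p) = 0"
  shows "moment_functional h (p * q) = 0"
proof (rule ccontr)
  define a b where "a = moment_functional h (p * q)" and "b = moment_functional h (q * q)"
  assume "moment_functional h (p * q) \<noteq> 0"
  then have "a \<noteq> 0" by (simp add: a_def)
  (* At this parameter the affine function b + 2ta has the value -1. *)
  define t where "t = - (b + 1) / (2 * a)"
  have "0 \<le> moment_functional h ((q + smult t p) * (q + smult t p))"
    using assms(1) by (simp add: hankel_positive_def)
  also have "(q + smult t p) * (q + smult t p) = q * q + smult (2 * t) (p * q) + smult (t\<^sup>2) (p * p)"
    by (subst poly_eq_poly_eq_iff[symmetric]) (auto simp: fun_eq_iff algebra_simps power2_eq_square)
  also have "moment_functional h \<dots> = b + 2 * t * a"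
    by (simp add: moment_functional_linear assms(2) a_def b_def)
  also have "\<dots> = -1" using \<open>a \<noteq> 0\<close> by (simp add: t_def field_simps)
  finally show False by simp
qed

text \<open>Gram-Schmidt for a form that need not be definite.  A basis vector of length zero
  is orthogonal to everything, so the division by zero in the coefficient of the new vector, which yields
  zero, gives the right value.\<close>

lemma orthogonal_projection_exists:
  assumes "hankel_positive h"
  shows "\<exists>r. (\<forall>i\<ge>n. coeff r i = 0) \<and>
             (\<forall>q. (\<forall>i\<ge>n. coeff q i = 0) \<longrightarrow> moment_functional h ((p - r) * q) = 0)"
proof (induction n arbitrary: p)
  case 0
  have "q = 0" if "\<forall>i\<ge>0. coeff q i = 0" for q :: "real poly"
    using that by (intro poly_eqI) auto
  then show ?case
    by (intro exI[of _ 0]) (metis coeff_0 moment_functional_0 mult_zero_right)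
next
  case (Suc n)
  obtain r where r: "\<forall>i\<ge>n. coeff r i = 0"
    "\<And>q. \<forall>i\<ge>n. coeff q i = 0 \<Longrightarrow> moment_functional h ((p - r) * q) = 0"
    using Suc.IH[of p] by blast
  obtain e where e: "\<forall>i\<ge>n. coeff e i = 0"
    "\<And>q. \<forall>i\<ge>n. coeff q i = 0 \<Longrightarrow> moment_functional h ((monom 1 n - e) * q) = 0"
    using Suc.IH[of "monom 1 n"] by blast
  define b where "b = monom 1 n - e"
  have b: "coeff b n = 1" "\<And>i. i > n \<Longrightarrow> coeff b i = 0"
    using e(1) by (auto simp: b_def)
  define c where "c = moment_functional h ((p - r) * b) / moment_functional h (b * b)"
  have c: "c * moment_functional h (b * b) = moment_functional h ((p - r) * b)"
    using null_polynomial_orthogonal[OF assms, of b "p - r"]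
    by (cases "moment_functional h (b * b) = 0") (auto simp: c_def mult.commute)
  show ?case
  proof (intro exI[of _ "r + smult c b"] conjI allI impI)
    fix i assume "Suc n \<le> i"
    then show "coeff (r + smult c b) i = 0" using r(1) b(2) by auto
  next
    fix q :: "real poly" assume q: "\<forall>i\<ge>Suc n. coeff q i = 0"
    define q' where "q' = q - smult (coeff q n) b"
    have q': "\<forall>i\<ge>n. coeff q' i = 0"
    proof (intro allI impI)
      fix i assume "n \<le> i"
      then show "coeff q' i = 0" using q b by (cases "i = n") (auto simp: q'_def)
    qed
    have "(p - (r + smult c b)) * q = (p - r) * q' - smult c (b * q')
        + smult (coeff q n) ((p - r) * b - smult c (b * b))"
      by (simp add: q'_def algebra_simps smult_diff_right smult_add_right)
    then show "moment_functional h ((p - (r + smult c b)) * q) = 0"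
      using r(2)[OF q'] e(2)[OF q', folded b_def] c by (simp add: moment_functional_linear)
  qed
qed

lemma prod_linear_factors_dvd:
  fixes q :: "'a::idom poly"
  assumes "finite A" "\<And>x. x \<in> A \<Longrightarrow> poly q x = 0"
  shows "(\<Prod>x\<in>A. [:-x, 1:]) dvd q"
  using assms
proof (induction A arbitrary: q rule: finite_induct)
  case (insert a A)
  obtain k where k: "q = [:-a, 1:] * k"
    using insert.prems[of a] by (auto simp: poly_eq_0_iff_dvd)
  have "poly k x = 0" if "x \<in> A" for x
    using insert.prems[of x] that insert.hyps by (auto simp: k)
  from insert.IH[OF this] show ?case
    using insert.hyps by (auto simp: k simp del: mult_pCons_left)
qed auto

lemma poly_map_poly_of_real:
  "poly (map_poly complex_of_real p) (complex_of_real x) = complex_of_real (poly p x)"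
  by (induction p) (auto simp: map_poly_pCons)

lemma map_poly_of_real_add:
  "map_poly complex_of_real (p + q) = map_poly complex_of_real p + map_poly complex_of_real q"
  by (intro poly_eqI) (simp add: coeff_map_poly)

lemma map_poly_of_real_mult:
  "map_poly complex_of_real (p * q) = map_poly complex_of_real p * map_poly complex_of_real q"
  by (intro poly_eqI) (simp add: coeff_map_poly coeff_mult)

text \<open>The quadratic \<open>[:a\<^sup>2 + b\<^sup>2, -2 * a, 1:]\<close> is \<open>(x - a)\<^sup>2 + b\<^sup>2\<close>.  Excluding such factors
  excludes at once the nonreal roots \<open>a + ib\<close> and, for \<open>b = 0\<close>, the multiple real roots.\<close>

lemma real_poly_split:
  fixes P :: "real poly"
  assumes "P \<noteq> 0" and no_sq: "\<And>a b R. P \<noteq> [:a\<^sup>2 + b\<^sup>2, -2 * a, 1:] * R"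
  shows "\<exists>c. c \<noteq> 0 \<and> P = smult c (\<Prod>x\<in>{x. poly P x = 0}. [:-x, 1:])"
proof -
  define G where "G = (\<Prod>x\<in>{x. poly P x = 0}. [:-x, 1:])"
  have fin: "finite {x. poly P x = 0}" using assms(1) by (rule poly_roots_finite)
  have "G dvd P" unfolding G_def using fin by (intro prod_linear_factors_dvd) auto
  then obtain H where H: "P = G * H" by auto
  have "degree H = 0"
  proof (rule ccontr)
    assume "degree H \<noteq> 0"
    then have "\<not> constant (poly (map_poly complex_of_real H))"
      by (simp add: constant_degree degree_map_poly)
    then obtain z where z: "poly (map_poly complex_of_real H) z = 0"
      using fundamental_theorem_of_algebra by blast
    define a b where "a = Re z" and "b = Im z"
    show False
    proof (cases "b = 0")
      case True
      then have "z = complex_of_real a" by (simp add: a_def b_def complex_eq_iff)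
      with z have "poly H a = 0" 
        by (simp add: poly_map_poly_of_real)
      then obtain H' where H': "H = [:-a, 1:] * H'" by (auto simp: poly_eq_0_iff_dvd)
      have "poly P a = 0" using \<open>poly H a = 0\<close> by (simp add: H)
      then have "poly G a = 0"
        unfolding G_def poly_prod using fin by (intro prod_zero) (auto intro!: bexI[of _ a])
      then obtain G' where G': "G = [:-a, 1:] * G'" by (auto simp: poly_eq_0_iff_dvd)
      have "P = ([:-a, 1:] * [:-a, 1:]) * (G' * H')"
        unfolding H by (subst G', subst H') (simp only: mult_ac)
      also have "[:-a, 1:] * [:-a, 1:] = [:a\<^sup>2 + 0\<^sup>2, -2 * a, 1:]"
        by (simp add: power2_eq_square)
      finally show False using no_sq by blast
    next
      case False
      define D where "D = [:a\<^sup>2 + b\<^sup>2, -2 * a, 1:]"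
      have D0: "poly (map_poly complex_of_real D) z = 0"
        by (simp add: D_def a_def b_def map_poly_pCons complex_eq_iff power2_eq_square algebra_simps)
      have "degree (H mod D) < 2"
        using degree_mod_less'[of D H] by (cases "H mod D = 0") (auto simp: D_def)
      then have "H mod D = [:coeff (H mod D) 0, coeff (H mod D) 1:]"
        by (intro poly_eqI) (auto simp: coeff_pCons coeff_eq_0 split: nat.splits)
      then obtain u v where uv: "H mod D = [:u, v:]" by blast
      have "H = D * (H div D) + [:u, v:]" unfolding uv[symmetric] by (rule mult_div_mod_eq[symmetric])
      then have "map_poly complex_of_real H = map_poly complex_of_real D * map_poly complex_of_real (H div D)
          + map_poly complex_of_real [:u, v:]"
        unfolding map_poly_of_real_mult[symmetric] map_poly_of_real_add[symmetric]
        by (rule arg_cong)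
      then have "poly (map_poly complex_of_real [:u, v:]) z = 0" using z D0 by simp
      then have "of_real u + z * of_real v = 0" by (simp add: map_poly_pCons)
      then have "u = 0 \<and> v = 0"
        using False by (auto simp: complex_eq_iff b_def)
      with \<open>H = D * (H div D) + [:u, v:]\<close> have "H = D * (H div D)" by simp
      then have "P = D * (G * (H div D))" using H by (simp add: mult.left_commute)
      then show False using no_sq unfolding D_def by blast
    qed
  qed
  then obtain c where "H = [:c:]" by (rule degree_eq_zeroE)
  then show ?thesis using H assms(1) unfolding G_def by (intro exI[of _ c]) auto
qed

text \<open>The nodes are the roots of a polynomial \<open>P\<close> that is orthogonal to all polynomials of degree at
  most \<open>N\<close>: a null polynomial of least degree if there is one of degree at most \<open>N + 1\<close>, and otherwise the
  orthogonal polynomial of degree \<open>N + 1\<close>.  In both cases the form is positive definite below the degree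
  of \<open>P\<close>, which forces the roots of \<open>P\<close> to be real and simple and makes the Lagrange weights
  nonnegative.\<close>

lemma gauss_quadrature:
  assumes h: "hankel_positive h"
  shows "\<exists>A w. finite A \<and> (\<forall>x. 0 \<le> w x) \<and> (\<forall>m\<le>N. (\<Sum>x\<in>A. w x * x ^ m) = h m)"
proof -
  let ?L = "moment_functional h"
  define null where "null d \<longleftrightarrow> (\<exists>q. q \<noteq> 0 \<and> degree q = d \<and> ?L (q * q) = 0)" for d
  define d where "d = (LEAST d. d = Suc N \<or> null d)"
  have d: "d = Suc N \<or> null d" unfolding d_def by (rule LeastI[of _ "Suc N"]) simp
  have "d \<le> Suc N" unfolding d_def by (rule Least_le) simp
  have pos: "0 < ?L (q * q)" if "q \<noteq> 0" "degree q < d" for q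
  proof -
    have "\<not> null (degree q)" using not_less_Least[of "degree q"] that(2) unfolding d_def by blast
    then have "?L (q * q) \<noteq> 0" using that(1) by (auto simp: null_def)
    then show ?thesis using h by (auto simp: hankel_positive_def less_le)
  qed
  (* If d comes from a null polynomial, that polynomial is orthogonal to everything; otherwise
     d = N + 1 and P is the monomial of this degree minus its projection. *)
  obtain P where P: "P \<noteq> 0" "degree P = d" "\<And>q. degree q \<le> N \<Longrightarrow> ?L (P * q) = 0"
  proof (cases "null d")
    case True
    then obtain q where "q \<noteq> 0" "degree q = d" "?L (q * q) = 0" by (auto simp: null_def)
    then show ?thesis using null_polynomial_orthogonal[OF h] that by blast
  next
    case False
    then have [simp]: "d = Suc N" using d by simp
    obtain r where r: "\<forall>i\<ge>Suc N. coeff r i = 0"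
      "\<And>q. \<forall>i\<ge>Suc N. coeff q i = 0 \<Longrightarrow> ?L ((monom 1 (Suc N) - r) * q) = 0"
      using orthogonal_projection_exists[OF h, of "Suc N" "monom 1 (Suc N)"] by blast
    have 1: "coeff (monom 1 (Suc N) - r) (Suc N) = 1" using r(1) by simp
    have 2: "degree (monom 1 (Suc N) - r) = Suc N"
      using 1 r(1) by (intro antisym degree_le le_degree) auto
    show ?thesis
    proof (rule that)
      show "monom 1 (Suc N) - r \<noteq> 0" using 2 by force
      show "degree (monom 1 (Suc N) - r) = d" using 2 by simp
      show "?L ((monom 1 (Suc N) - r) * q) = 0" if "degree q \<le> N" for q
        using that by (intro r(2)) (auto simp: coeff_eq_0)
    qed
  qed
  (* For a factorisation P = ((x - a)^2 + b^2) R the functional would vanish on P R, which is the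
     sum of the squares of (x - a) R and b R; but the functional is positive on the first square,
     because (x - a) R has degree below d. *)
  have no_sq: "P \<noteq> [:a\<^sup>2 + b\<^sup>2, -2 * a, 1:] * R" for a b R
  proof
    assume eq: "P = [:a\<^sup>2 + b\<^sup>2, -2 * a, 1:] * R"
    have "R \<noteq> 0" using P(1) eq by auto
    then have "degree P = 2 + degree R" unfolding eq by (subst degree_mult_eq) auto
    then have degR: "degree R + 2 = d" using P(2) by simp
    have "P * R = ([:-a, 1:] * R) * ([:-a, 1:] * R) + smult (b\<^sup>2) (R * R)"
    proof -
      have "[:a\<^sup>2 + b\<^sup>2, -2 * a, 1:] = [:-a, 1:] * [:-a, 1:] + [:b\<^sup>2:]"
        by (simp add: power2_eq_square)
      then show ?thesis unfolding eq by (simp add: algebra_simps del: mult_pCons_left mult_pCons_right)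
          (simp add: algebra_simps)
    qed
    then have "?L (P * R) = ?L (([:-a, 1:] * R) * ([:-a, 1:] * R)) + b\<^sup>2 * ?L (R * R)"
      by (simp only: moment_functional_linear)
    moreover have "degree ([:-a, 1:] * R) < d"
      using degR \<open>R \<noteq> 0\<close> by (subst degree_mult_eq) auto
    then have "0 < ?L (([:-a, 1:] * R) * ([:-a, 1:] * R))"
      using \<open>R \<noteq> 0\<close> by (intro pos) (auto simp del: mult_pCons_left)
    moreover have "0 \<le> b\<^sup>2 * ?L (R * R)" using h by (simp add: hankel_positive_def)
    moreover have "?L (P * R) = 0" using degR \<open>d \<le> Suc N\<close> by (intro P(3)) auto
    ultimately show False by linarith
  qed
  define A where "A = {x. poly P x = 0}"
  have fin: "finite A" unfolding A_def using P(1) by (rule poly_roots_finite)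
  obtain c where c: "c \<noteq> 0" "P = smult c (\<Prod>x\<in>A. [:-x, 1:])"
    using real_poly_split[OF P(1) no_sq] unfolding A_def by blast
  have cardA: "card A = d"
    using P(2) c fin by (simp add: degree_prod_eq_sum_degree)
  have vanish: "?L q = 0" if "\<And>x. x \<in> A \<Longrightarrow> poly q x = 0" "degree q \<le> N + d" for q
  proof -
    have "P dvd q" unfolding c(2) using c(1) prod_linear_factors_dvd[OF fin that(1)]
      by (simp add: smult_dvd)
    then obtain k where k: "q = P * k" by auto
    have "degree k \<le> N"
      using that(2) P(1,2) by (cases "k = 0") (auto simp: k degree_mult_eq)
    then show ?thesis unfolding k by (rule P(3))
  qed
  (* The Lagrange basis of the nodes; the weights are its values under the functional. *)
  define l where "l x = smult (1 / (\<Prod>y\<in>A-{x}. x - y)) (\<Prod>y\<in>A-{x}. [:-y, 1:])" for x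
  have l_eval: "poly (l x) y = (if y = x then 1 else 0)" if "x \<in> A" "y \<in> A" for x y
  proof (cases "y = x")
    case True
    have "(\<Prod>y\<in>A-{x}. x - y) \<noteq> 0" using fin by auto
    then show ?thesis using True by (simp add: l_def poly_prod)
  next
    case False
    then show ?thesis using that fin by (auto simp: l_def poly_prod)
  qed
  have l_deg: "degree (l x) < d" if "x \<in> A" for x
  proof -
    have "degree (l x) \<le> degree (\<Prod>y\<in>A-{x}. [:-y, 1:])"
      unfolding l_def by (rule degree_smult_le)
    also have "\<dots> = card (A - {x})" by (subst degree_prod_eq_sum_degree) auto
    also have "\<dots> < d" using that fin cardA by (metis card_Diff1_less)
    finally show ?thesis .
  qed
  define w where "w x = (if x \<in> A then ?L (l x) else 0)" for x
  have w_nonneg: "0 \<le> w x" for x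
  proof (cases "x \<in> A")
    case True
    have "degree (l x * l x) \<le> degree (l x) + degree (l x)" by (rule degree_mult_le)
    then have "degree (l x * l x) \<le> N + d" "degree (l x) \<le> N + d"
      using l_deg[OF True] \<open>d \<le> Suc N\<close> by linarith+
    (* The square of a Lagrange polynomial agrees with it at the nodes, so its weight is the
       functional of a square. *)
    then have "?L (l x * l x - l x) = 0"
      by (intro vanish) (auto simp: l_eval True intro: order.trans[OF degree_diff_le_max])
    then have "?L (l x) = ?L (l x * l x)" by (simp add: moment_functional_linear)
    then show ?thesis using True h by (simp add: w_def hankel_positive_def)
  qed (simp add: w_def)
  have "(\<Sum>x\<in>A. w x * x ^ m) = h m" if "m \<le> N" for m
  proof -
    define q where "q = (\<Sum>x\<in>A. smult (x ^ m) (l x))"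
    have "degree (smult (x ^ m) (l x)) \<le> N + d" if "x \<in> A" for x
      using l_deg[OF that] degree_smult_le[of "x ^ m" "l x"] by linarith
    then have "degree q \<le> N + d" unfolding q_def by (intro degree_sum_le fin) auto
    moreover have "degree (monom (1::real) m) \<le> N + d"
      using that degree_monom_le[of "1::real" m] by linarith
    moreover have "poly q y = y ^ m" if "y \<in> A" for y
    proof -
      have "poly q y = (\<Sum>x\<in>A. if x = y then y ^ m else 0)"
        unfolding q_def poly_sum using l_eval[OF _ that] by (intro sum.cong) auto
      then show ?thesis using fin that by simp
    qed
    ultimately have "?L (monom 1 m - q) = 0"
      by (intro vanish) (auto simp: poly_monom intro: order.trans[OF degree_diff_le_max])
    then have "h m = ?L q" by (simp add: moment_functional_linear moment_functional_monom)
    also have "\<dots> = (\<Sum>x\<in>A. w x * x ^ m)"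
      by (simp add: q_def moment_functional_sum moment_functional_smult w_def mult.commute)
    finally show ?thesis by simp
  qed
  then show ?thesis using fin w_nonneg by blast
qed

section \<open>Fejer means of a positive sequence\<close>

text \<open>Zero coefficients contribute nothing, so the sums may run over rectangles of indices.\<close>

lemma devinatz_positive_sum:
  assumes "devinatz_positive s" "finite F"
  shows "0 \<le> (\<Sum>(m, n)\<in>F. \<Sum>(k, l)\<in>F. \<alpha> m n * cnj (\<alpha> k l) * s (m + k) (n - l))"
proof -
  define \<beta> where "\<beta> m n = (if (m, n) \<in> F then \<alpha> m n else 0)" for m n
  let ?S = "{(m, n). \<beta> m n \<noteq> 0}"
  have sub: "?S \<subseteq> F" by (auto simp: \<beta>_def split: if_splits)
  then have fin: "finite ?S" using assms(2) by (rule finite_subset)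
  have "0 \<le> (\<Sum>(m, n)\<in>?S. \<Sum>(k, l)\<in>?S. \<beta> m n * cnj (\<beta> k l) * s (m + k) (n - l))"
    using assms(1) fin unfolding devinatz_positive_def by blast
  also have "\<dots> = (\<Sum>(m, n)\<in>?S. \<Sum>(k, l)\<in>F. \<beta> m n * cnj (\<beta> k l) * s (m + k) (n - l))"
    using sub by (intro sum.cong refl) (auto intro!: sum.mono_neutral_left assms(2))
  also have "\<dots> = (\<Sum>(m, n)\<in>F. \<Sum>(k, l)\<in>F. \<beta> m n * cnj (\<beta> k l) * s (m + k) (n - l))"
    using sub by (intro sum.mono_neutral_left assms(2)) auto
  also have "\<dots> = (\<Sum>(m, n)\<in>F. \<Sum>(k, l)\<in>F. \<alpha> m n * cnj (\<alpha> k l) * s (m + k) (n - l))"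
    by (intro sum.cong refl) (auto simp: \<beta>_def intro!: sum.cong)
  finally show ?thesis .
qed

text \<open>Up to a constant factor these are the moments in \<open>x\<close> of the Fejer mean of a solution at
  the angle \<open>2\<pi>\<theta>\<close>.\<close>

definition fejer_slice :: "(nat \<Rightarrow> int \<Rightarrow> complex) \<Rightarrow> nat \<Rightarrow> real \<Rightarrow> nat \<Rightarrow> complex" where
  "fejer_slice s N \<theta> m =
     (\<Sum>n\<le>N. \<Sum>l\<le>N. cis (- 2 * pi * (real n - real l) * \<theta>) * s m (int n - int l))"

text \<open>Apply positivity to the coefficients \<open>c\<^sub>m e\<^bsup>-2\<pi>in\<theta>\<^esup>\<close> for \<open>0 \<le> n \<le> N\<close>.\<close>

lemma fejer_slice_form_nonneg:
  assumes "devinatz_positive s"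
  shows "0 \<le> (\<Sum>i\<le>d. \<Sum>j\<le>d. complex_of_real (c i * c j) * fejer_slice s N \<theta> (i + j))"
proof -
  let ?F = "{..d} \<times> int ` {..N}"
  define \<alpha> where "\<alpha> m n = complex_of_real (c m) * cis (- 2 * pi * of_int n * \<theta>)" for m :: nat and n :: int
  have split: "(\<Sum>(m, n)\<in>?F. g m n) = (\<Sum>m\<le>d. \<Sum>n\<le>N. g m (int n))"
    for g :: "nat \<Rightarrow> int \<Rightarrow> complex"
    by (simp add: sum.cartesian_product[symmetric] sum.reindex)
  have "0 \<le> (\<Sum>(m, n)\<in>?F. \<Sum>(k, l)\<in>?F. \<alpha> m n * cnj (\<alpha> k l) * s (m + k) (n - l))"
    by (intro devinatz_positive_sum assms) auto
  also have "\<dots> = (\<Sum>m\<le>d. \<Sum>n\<le>N. \<Sum>k\<le>d. \<Sum>l\<le>N.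
      \<alpha> m (int n) * cnj (\<alpha> k (int l)) * s (m + k) (int n - int l))"
    unfolding split ..
  also have "\<dots> = (\<Sum>m\<le>d. \<Sum>k\<le>d. \<Sum>n\<le>N. \<Sum>l\<le>N.
      \<alpha> m (int n) * cnj (\<alpha> k (int l)) * s (m + k) (int n - int l))"
    by (intro sum.cong refl sum.swap)
  also have "\<dots> = (\<Sum>m\<le>d. \<Sum>k\<le>d. complex_of_real (c m * c k) * fejer_slice s N \<theta> (m + k))"
    unfolding fejer_slice_def sum_distrib_left \<alpha>_def
    by (intro sum.cong refl) (simp add: cis_cnj cis_mult algebra_simps)
  finally show ?thesis .
qed

lemma moment_functional_fejer_slice:
  assumes "devinatz_positive s"
  shows "0 \<le> moment_functional (\<lambda>m. Re (fejer_slice s N \<theta> m)) (p * p)"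
    and "moment_functional (\<lambda>m. Im (fejer_slice s N \<theta> m)) (p * p) = 0"
  using fejer_slice_form_nonneg[OF assms, where c = "coeff p" and d = "degree p" and N = N and \<theta> = \<theta>]
  by (auto simp: moment_functional_mult less_eq_complex_def)

text \<open>The imaginary parts define a functional that vanishes on squares, and
  \<open>4x\<^sup>m = (x\<^sup>m + 1)\<^sup>2 - (x\<^sup>m - 1)\<^sup>2\<close>.\<close>

lemma fejer_slice_real:
  assumes "devinatz_positive s"
  shows "fejer_slice s N \<theta> m = complex_of_real (Re (fejer_slice s N \<theta> m))"
proof -
  let ?L = "moment_functional (\<lambda>m. Im (fejer_slice s N \<theta> m))"
  have "smult 4 (monom 1 m) = (monom 1 m + 1) * (monom 1 m + 1) - (monom 1 m - 1) * (monom 1 m - (1::real poly))"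
    by (subst poly_eq_poly_eq_iff[symmetric]) (auto simp: fun_eq_iff algebra_simps poly_monom)
  then have "?L (smult 4 (monom 1 m)) = 0"
    using moment_functional_fejer_slice(2)[OF assms, of N \<theta> "monom 1 m + 1"]
      moment_functional_fejer_slice(2)[OF assms, of N \<theta> "monom 1 m - 1"]
    by (simp only: moment_functional_diff)
  then have "Im (fejer_slice s N \<theta> m) = 0"
    by (simp only: moment_functional_smult moment_functional_monom)
  then show ?thesis by (simp add: complex_eq_iff)
qed

lemma sum_cis_roots_of_unity:
  fixes j :: int
  assumes "\<bar>j\<bar> < int Q"
  shows "(\<Sum>r<Q. cis (2 * pi * of_int j * (real r / real Q))) = (if j = 0 then of_nat Q else 0)"
proof (cases "j = 0")
  case False
  define \<omega> where "\<omega> = cis (2 * pi * of_int j / real Q)"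
  have Q: "0 < Q" using assms by auto
  have "\<omega> \<noteq> 1"
  proof
    assume "\<omega> = 1"
    then obtain n :: int where "2 * pi * of_int j / real Q = of_int (2 * n) * pi"
      by (auto simp: \<omega>_def cis_conv_exp exp_eq_1)
    then have "real_of_int j = of_int n * real Q" using Q by (simp add: field_simps)
    then have "j = n * int Q" by (metis of_int_eq_iff of_int_mult of_int_of_nat_eq)
    then have "int Q dvd j" by simp
    then show False using assms False by (auto dest: dvd_imp_le_int)
  qed
  moreover have "\<omega> ^ Q = 1"
  proof -
    have "\<omega> ^ Q = cis (real Q * (2 * pi * of_int j / real Q))" unfolding \<omega>_def by (rule Complex.DeMoivre)
    also have "real Q * (2 * pi * of_int j / real Q) = 2 * pi * of_int j" using Q by simp
    also have "cis (2 * pi * of_int j) = 1" by (rule cis_multiple_2pi) auto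
    finally show ?thesis .
  qed
  ultimately have "(\<Sum>r<Q. \<omega> ^ r) = 0" by (simp add: sum_gp_strict)
  moreover have "cis (2 * pi * of_int j * (real r / real Q)) = \<omega> ^ r" for r
    unfolding \<omega>_def Complex.DeMoivre by (simp add: mult.commute)
  ultimately show ?thesis using False by simp
qed simp

lemma sum_diff_indicator:
  fixes k :: int
  assumes "\<bar>k\<bar> \<le> int N"
  shows "(\<Sum>n\<le>N. \<Sum>l\<le>N. if int n - int l = k then 1 else 0) = real (Suc N) - \<bar>of_int k\<bar>"
proof -
  have "(\<Sum>l\<le>N. if int n - int l = k then 1 else 0) =
      (if n \<in> {nat k..nat (min (int N) (int N + k))} then 1 else (0::real))" if "n \<le> N" for n
  proof (cases "n \<in> {nat k..nat (min (int N) (int N + k))}")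
    case True
    have "(\<Sum>l\<le>N. if int n - int l = k then 1 else 0) = (\<Sum>l\<le>N. if l = nat (int n - k) then 1 else (0::real))"
      using True by (intro sum.cong) auto
    then show ?thesis using True assms by auto
  next
    case False
    then show ?thesis using that assms by (auto intro!: sum.neutral)
  qed
  then have "(\<Sum>n\<le>N. \<Sum>l\<le>N. if int n - int l = k then 1 else 0)
      = (\<Sum>n\<le>N. if n \<in> {nat k..nat (min (int N) (int N + k))} then 1 else (0::real))"
    by (intro sum.cong) auto
  also have "\<dots> = real (card ({..N} \<inter> {nat k..nat (min (int N) (int N + k))}))"
    by (subst sum.inter_restrict[symmetric]) auto
  also have "{..N} \<inter> {nat k..nat (min (int N) (int N + k))} = {nat k..nat (min (int N) (int N + k))}"
    by auto
  also have "real (card \<dots>) = real (Suc N) - \<bar>of_int k\<bar>"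
    using assms by (cases "0 \<le> k") (auto simp: min_def)
  finally show ?thesis .
qed

text \<open>Atoms are indexed by the number \<open>r\<close> of the angle and the position \<open>x\<close> on the line; angles are
  measured in full turns.  Since \<open>|k - (n - l)| \<le> 2N\<close>, averaging over \<open>2N + 1\<close> equidistant angles
  already separates the frequencies, and \<open>n - l = k\<close> has \<open>N + 1 - |k|\<close> solutions.\<close>

lemma fejer_atomic_measures:
  assumes s: "devinatz_positive s"
  obtains I :: "(nat \<times> real) set" and w \<theta> where
    "finite I" "\<And>i. 0 \<le> w i" "\<And>i. i \<in> I \<Longrightarrow> 0 \<le> \<theta> i \<and> \<theta> i < 1"
    "\<And>m k. m \<le> N \<Longrightarrow> \<bar>k\<bar> \<le> int N \<Longrightarrow>
       (\<Sum>i\<in>I. w i *\<^sub>R (complex_of_real (snd i) ^ m * cis (2 * pi * of_int k * \<theta> i)))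
         = (1 - \<bar>of_int k\<bar> / real (Suc N)) *\<^sub>R s m k"
proof -
  define Q where "Q = Suc (2 * N)"
  have "0 < Q" by (simp add: Q_def)
  define h where "h r m = Re (fejer_slice s N (real r / real Q) m)" for r m
  have "hankel_positive (h r)" for r
    unfolding hankel_positive_def h_def using moment_functional_fejer_slice(1)[OF s] by blast
  then have "\<forall>r. \<exists>A w. finite A \<and> (\<forall>x. 0 \<le> w x) \<and> (\<forall>m\<le>N. (\<Sum>x\<in>A. w x * x ^ m) = h r m)"
    using gauss_quadrature by blast
  then obtain A w where A: "\<And>r. finite (A r)" and w: "\<And>r x. 0 \<le> w r x"
    and quad: "\<And>r m. m \<le> N \<Longrightarrow> (\<Sum>x\<in>A r. w r x * x ^ m) = h r m"
    by metis
  define I where "I = Sigma {..<Q} A"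
  define v where "v i = w (fst i) (snd i) / (real Q * real (Suc N))" for i :: "nat \<times> real"
  define \<theta> where "\<theta> i = real (fst i) / real Q" for i :: "nat \<times> real"
  have "(\<Sum>i\<in>I. v i *\<^sub>R (complex_of_real (snd i) ^ m * cis (2 * pi * of_int k * \<theta> i)))
      = (1 - \<bar>of_int k\<bar> / real (Suc N)) *\<^sub>R s m k" if m: "m \<le> N" and k: "\<bar>k\<bar> \<le> int N" for m k
  proof -
    define C where "C = complex_of_real (real Q * real (Suc N))"
    have "(\<Sum>i\<in>I. v i *\<^sub>R (complex_of_real (snd i) ^ m * cis (2 * pi * of_int k * \<theta> i)))
       = (\<Sum>r<Q. \<Sum>x\<in>A r. v (r, x) *\<^sub>R (complex_of_real x ^ m * cis (2 * pi * of_int k * (real r / real Q))))"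
      unfolding I_def by (subst sum.Sigma) (auto simp: A \<theta>_def intro!: sum.cong)
    also have "\<dots> = (\<Sum>r<Q. cis (2 * pi * of_int k * (real r / real Q)) *
        complex_of_real (\<Sum>x\<in>A r. w r x * x ^ m) / C)"
      by (simp add: sum_distrib_left sum_distrib_right sum_divide_distrib v_def C_def scaleR_conv_of_real mult_ac)
    also have "\<dots> = (\<Sum>r<Q. cis (2 * pi * of_int k * (real r / real Q)) *
        fejer_slice s N (real r / real Q) m) / C"
      using fejer_slice_real[OF s] by (simp add: quad[OF m] h_def sum_divide_distrib)
    also have "(\<Sum>r<Q. cis (2 * pi * of_int k * (real r / real Q)) * fejer_slice s N (real r / real Q) m)
      = (\<Sum>r<Q. \<Sum>n\<le>N. \<Sum>l\<le>N. cis (2 * pi * of_int (k - (int n - int l)) * (real r / real Q)) * s m (int n - int l))"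
      unfolding fejer_slice_def sum_distrib_left
      by (intro sum.cong refl) (simp add: mult.assoc[symmetric] cis_mult,
         simp add: algebra_simps diff_divide_distrib add_divide_distrib)
    also have "\<dots> = (\<Sum>n\<le>N. \<Sum>r<Q. \<Sum>l\<le>N. cis (2 * pi * of_int (k - (int n - int l)) * (real r / real Q)) * s m (int n - int l))"
      by (rule sum.swap)
    also have "\<dots> = (\<Sum>n\<le>N. \<Sum>l\<le>N. \<Sum>r<Q. cis (2 * pi * of_int (k - (int n - int l)) * (real r / real Q)) * s m (int n - int l))"
      by (intro sum.cong refl sum.swap)
    also have "\<dots> = (\<Sum>n\<le>N. \<Sum>l\<le>N. (\<Sum>r<Q. cis (2 * pi * of_int (k - (int n - int l)) * (real r / real Q))) * s m (int n - int l))"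
      by (simp only: sum_distrib_right)
    also have "\<dots> = (\<Sum>n\<le>N. \<Sum>l\<le>N. complex_of_real (if int n - int l = k then 1 else 0) * (of_nat Q * s m k))"
    proof (intro sum.cong refl)
      fix n l assume "n \<in> {..N}" "l \<in> {..N}"
      then have "\<bar>k - (int n - int l)\<bar> < int Q" using k by (auto simp: Q_def)
      from sum_cis_roots_of_unity[OF this]
      show "(\<Sum>r<Q. cis (2 * pi * of_int (k - (int n - int l)) * (real r / real Q))) * s m (int n - int l)
          = complex_of_real (if int n - int l = k then 1 else 0) * (of_nat Q * s m k)"
        by auto
    qed
    also have "\<dots> = complex_of_real (\<Sum>n\<le>N. \<Sum>l\<le>N. if int n - int l = k then 1 else 0) * (of_nat Q * s m k)"
      by (simp only: sum_distrib_right of_real_sum)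
    also have "\<dots> / C = (1 - \<bar>of_int k\<bar> / real (Suc N)) *\<^sub>R s m k"
    proof -
      have "(real (Suc N) - \<bar>of_int k\<bar>) * real Q / (real Q * real (Suc N)) = 1 - \<bar>of_int k\<bar> / real (Suc N)"
        using \<open>0 < Q\<close> by (simp add: mult.commute[of _ "real Q"] diff_divide_distrib del: of_nat_Suc)
      then have eq: "complex_of_real (1 - \<bar>of_int k\<bar> / real (Suc N)) =
          complex_of_real (real (Suc N) - \<bar>of_int k\<bar>) * complex_of_real (real Q) / C"
        unfolding C_def by (metis of_real_divide of_real_mult)
      show ?thesis
        unfolding sum_diff_indicator[OF k] scaleR_conv_of_real eq
        by (simp only: times_divide_eq_left mult.assoc of_real_of_nat_eq)
    qed
    finally show ?thesis .
  qed
  moreover have "finite I" using A by (simp add: I_def)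
  moreover have "0 \<le> v i" for i using w by (simp add: v_def)
  moreover have "0 \<le> \<theta> i \<and> \<theta> i < 1" if "i \<in> I" for i using that by (auto simp: I_def \<theta>_def)
  ultimately show thesis by (intro that[of I v \<theta>])
qed

section \<open>A space-filling curve with parameter on the real line\<close>

text \<open>The partial sums telescope to the dyadic approximations \<open>\<lfloor>2\<^sup>n x\<rfloor> / 2\<^sup>n\<close> from below.\<close>

lemma binary_expansion:
  fixes x :: real
  shows "(\<lambda>n. real_of_int (\<lfloor>2 ^ Suc n * x\<rfloor> - 2 * \<lfloor>2 ^ n * x\<rfloor>) / 2 ^ Suc n) sums (x - of_int \<lfloor>x\<rfloor>)"
proof -
  define b where "b n = real_of_int \<lfloor>2 ^ n * x\<rfloor> / 2 ^ n" for n
  have digit: "real_of_int (\<lfloor>2 ^ Suc n * x\<rfloor> - 2 * \<lfloor>2 ^ n * x\<rfloor>) / 2 ^ Suc n = b (Suc n) - b n" for n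
    by (simp add: b_def field_simps)
  have "b \<longlonglongrightarrow> x"
  proof (rule tendsto_sandwich)
    show "\<forall>\<^sub>F n in sequentially. x - (1/2) ^ n \<le> b n"
    proof (intro always_eventually allI)
      fix n
      have "2 ^ n * x - 1 \<le> of_int \<lfloor>2 ^ n * x\<rfloor>" by linarith
      then have "(2 ^ n * x - 1) / 2 ^ n \<le> b n" unfolding b_def by (rule divide_right_mono) simp
      then show "x - (1/2) ^ n \<le> b n" by (simp add: field_simps)
    qed
    show "\<forall>\<^sub>F n in sequentially. b n \<le> x"
      by (intro always_eventually allI) (simp add: b_def field_simps)
    have "(\<lambda>n. x - (1/2) ^ n) \<longlonglongrightarrow> x - 0"
      by (intro tendsto_intros LIMSEQ_power_zero) auto
    then show "(\<lambda>n. x - (1/2) ^ n) \<longlonglongrightarrow> x" by simp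
  qed simp
  from telescope_sums[OF this] show ?thesis unfolding digit by (simp add: b_def)
qed

lemma binary_digit:
  fixes x :: real
  shows "\<lfloor>2 ^ Suc n * x\<rfloor> - 2 * \<lfloor>2 ^ n * x\<rfloor> \<in> {0, 1}"
proof -
  have "2 * \<lfloor>2 ^ n * x\<rfloor> \<le> \<lfloor>2 ^ Suc n * x\<rfloor>" "\<lfloor>2 ^ Suc n * x\<rfloor> < 2 * \<lfloor>2 ^ n * x\<rfloor> + 2"
    by (simp_all add: le_floor_iff floor_less_iff) linarith+
  then show ?thesis by auto
qed

text \<open>A continuous function of period one that reads the leading base 6 digit of the fractional part
  when this digit is 0 or 3: it is 0 on \<open>[0, 1/6]\<close> and 1 on \<open>[1/2, 2/3]\<close>.  Base 6 is chosen because the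
  cosine takes the value \<open>1/2\<close> at a sixth of a turn.\<close>

definition digit_reader :: "real \<Rightarrow> real" where
  "digit_reader t = max 0 (min 1 (1 / 2 - cos (2 * pi * t)))"

text \<open>A continuous substitute for the integer part.  A number all of whose base 6 digits after the
  point are 0 or 3 has fractional part at most \<open>3/5\<close>, and up to there the substitute is exact; on the
  remaining part of the unit interval it climbs linearly to the next integer.\<close>

definition staircase :: "real \<Rightarrow> real" where
  "staircase t = of_int \<lfloor>t\<rfloor> + max 0 (5 / 2 * frac t - 3 / 2)"

text \<open>For \<open>j = 0\<close> and \<open>j = 1\<close> the two coordinates of a curve like Schoenberg's space-filling curve, with
  base 6 in place of base 3: if the base 6 digits of \<open>t\<close> are 0 or 3, those at the places of one parity
  become the binary digits of one coordinate.\<close>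

definition digit_series :: "nat \<Rightarrow> real \<Rightarrow> real" where
  "digit_series j t = (\<Sum>n. digit_reader (6 ^ (2 * n + j) * t) / 2 ^ Suc n)"

lemma digit_reader_bounds: "0 \<le> digit_reader t" "digit_reader t \<le> 1"
  by (auto simp: digit_reader_def)

lemma digit_reader_term_le: "norm (digit_reader u / 2 ^ Suc n) \<le> (1 / 2) ^ Suc n"
  using digit_reader_bounds[of u] by (simp add: power_one_over divide_simps)

lemma summable_half: "summable (\<lambda>n. (1 / 2 :: real) ^ Suc n)"
  using power_half_series by (rule sums_summable)

lemma continuous_digit_series: "continuous_on UNIV (digit_series j)"
proof -
  have "uniform_limit UNIV (\<lambda>n t. \<Sum>i<n. digit_reader (6 ^ (2 * i + j) * t) / 2 ^ Suc i)
      (\<lambda>t. \<Sum>i. digit_reader (6 ^ (2 * i + j) * t) / 2 ^ Suc i) sequentially"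
    by (rule Weierstrass_m_test[OF digit_reader_term_le summable_half])
  then show ?thesis unfolding digit_series_def
    by (rule uniform_limit_theorem[rotated])
       (auto simp: digit_reader_def intro!: always_eventually continuous_intros)
qed

lemma digit_series_bounds: "0 \<le> digit_series j t" "digit_series j t \<le> 1"
proof -
  have s: "summable (\<lambda>n. digit_reader (6 ^ (2 * n + j) * t) / 2 ^ Suc n)"
    by (rule summable_comparison_test'[OF summable_half, of 0]) (rule digit_reader_term_le)
  show "0 \<le> digit_series j t"
    unfolding digit_series_def by (intro suminf_nonneg s) (simp add: digit_reader_bounds)
  have "digit_series j t \<le> (\<Sum>n. (1 / 2 :: real) ^ Suc n)"
    unfolding digit_series_def
    by (intro suminf_le s summable_half) (use digit_reader_term_le in \<open>auto intro: order.trans[OF abs_ge_self]\<close>)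
  then show "digit_series j t \<le> 1" using power_half_series by (simp add: sums_unique[symmetric])
qed

lemma staircase_bounds: "\<bar>staircase t - t\<bar> \<le> 1"
proof -
  have "0 \<le> frac t" "frac t < 1" "t = of_int \<lfloor>t\<rfloor> + frac t"
    using frac_ge_0[of t] frac_lt_1[of t] by (auto simp: frac_def)
  then show ?thesis unfolding staircase_def by linarith
qed

text \<open>The only problem is at the integers; near an integer \<open>k\<close> both branches are given by one
  continuous formula.\<close>

lemma continuous_staircase: "continuous_on UNIV staircase"
proof (rule continuous_at_imp_continuous_on, rule ballI)
  fix t :: real
  define k where "k = \<lfloor>t\<rfloor>"
  have t: "of_int k - 2 / 5 < t" "t < of_int k + 1" unfolding k_def by linarith+
  define g where "g u = of_int k + max 0 (5 / 2 * (u - of_int k) - 3 / 2) + min 0 (5 / 2 * (u - of_int k))" for u :: real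
  have eq: "staircase u = g u" if "u \<in> {of_int k - 2 / 5<..<of_int k + 1}" for u
  proof (cases "u < of_int k")
    case True
    then have "\<lfloor>u\<rfloor> = k - 1" using that by (intro floor_unique) auto
    then show ?thesis using that True
      by (simp add: staircase_def g_def frac_def max_def min_def field_simps)
  next
    case False
    then have "\<lfloor>u\<rfloor> = k" using that by (intro floor_unique) auto
    then show ?thesis using that False
      by (simp add: staircase_def g_def frac_def max_def min_def field_simps)
  qed
  have "isCont g t" unfolding g_def by (intro continuous_intros)
  moreover have "\<forall>\<^sub>F u in nhds t. staircase u = g u"
    unfolding eventually_nhds using eq t
    by (intro exI[of _ "{of_int k - 2 / 5<..<of_int k + 1}"]) auto
  ultimately show "isCont staircase t" using isCont_cong by blast
qed

lemma digit_reader_shift: "digit_reader (of_int k + u) = digit_reader u"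
proof -
  have "cos (2 * pi * (of_int k + u)) = cos (2 * pi * u + 2 * pi * of_int k)" by (simp add: algebra_simps)
  also have "\<dots> = cos (2 * pi * u)" by (simp only: cos_add cos_int_2pin sin_int_2pin mult_1_right mult_zero_right diff_0_right)
  finally show ?thesis by (simp add: digit_reader_def)
qed

lemma digit_reader_read:
  assumes "d \<in> {0, 1}" "0 \<le> u" "u \<le> 1 / 6"
  shows "digit_reader (d / 2 + u) = d"
proof -
  have *: "1 / 2 \<le> cos (2 * pi * u)"
  proof -
    have "2 * pi * u \<le> pi / 3" using assms(3) by (simp add: field_simps)
    then have "cos (pi / 3) \<le> cos (2 * pi * u)"
      using assms(2) by (intro cos_monotone_0_pi_le) auto
    then show ?thesis by (simp add: cos_60)
  qed
  have "cos (2 * pi * (1 / 2 + u)) = - cos (2 * pi * u)"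
    by (simp add: cos_add ring_distribs)
  then show ?thesis using assms(1) * by (auto simp: digit_reader_def)
qed

text \<open>Multiplication by \<open>6\<^sup>n\<close> moves the first \<open>n\<close> digits into the integer part, which the periodic
  \<open>digit_reader\<close> ignores; the digits after the next one contribute at most \<open>1/10 \<le> 1/6\<close>.\<close>

lemma expansion_base_6:
  fixes a :: "nat \<Rightarrow> real"
  assumes a: "\<And>n. a n \<in> {0, 1}"
  defines "t \<equiv> (\<Sum>n. a n * (3 / 6 ^ Suc n))"
  shows "0 \<le> t" "t \<le> 3 / 5" "\<And>n. digit_reader (6 ^ n * (of_int k + t)) = a n"
proof -
  have geo: "(\<lambda>n. 3 / 6 ^ Suc n :: real) sums (3 / 5)"
  proof -
    have "(\<lambda>n. (1 / 2) * (1 / 6 :: real) ^ n) sums ((1 / 2) * (1 / (1 - 1 / 6)))"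
      by (intro sums_mult geometric_sums) simp
    then show ?thesis by (simp add: power_one_over field_simps)
  qed
  have sm: "summable (\<lambda>n. b n * (3 / 6 ^ Suc n))" if "\<And>n. b n \<in> {0, 1}" for b :: "nat \<Rightarrow> real"
  proof (rule summable_comparison_test'[OF sums_summable[OF geo], of 0])
    show "norm (b n * (3 / 6 ^ Suc n)) \<le> 3 / 6 ^ Suc n" for n using that[of n] by auto
  qed
  have tail: "0 \<le> (\<Sum>n. b n * (3 / 6 ^ Suc n))" "(\<Sum>n. b n * (3 / 6 ^ Suc n)) \<le> 3 / 5"
    if b: "\<And>n. b n \<in> {0, 1}" for b :: "nat \<Rightarrow> real"
  proof -
    have b': "0 \<le> b n" "b n \<le> 1" for n using b[of n] by auto
    show "0 \<le> (\<Sum>n. b n * (3 / 6 ^ Suc n))" using b' by (intro suminf_nonneg sm b) auto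
    have "(\<Sum>n. b n * (3 / 6 ^ Suc n)) \<le> (\<Sum>n. 3 / 6 ^ Suc n)"
      using b'(2) by (intro suminf_le sm b sums_summable[OF geo]) (auto simp: divide_right_mono)
    then show "(\<Sum>n. b n * (3 / 6 ^ Suc n)) \<le> 3 / 5" using sums_unique[OF geo] by simp
  qed
  have first_digit: "(\<Sum>n. b n * (3 / 6 ^ Suc n)) = b 0 / 2 + (\<Sum>n. b (Suc n) * (3 / 6 ^ Suc n)) / 6"
    if b: "\<And>n. b n \<in> {0, 1}" for b :: "nat \<Rightarrow> real"
  proof -
    have "(\<Sum>n. b (Suc n) * (3 / 6 ^ Suc (Suc n))) = (\<Sum>n. b n * (3 / 6 ^ Suc n)) - b 0 * (3 / 6 ^ Suc 0)"
      using suminf_split_head[OF sm[of b, OF b]] .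
    moreover have "(\<Sum>n. b (Suc n) * (3 / 6 ^ Suc (Suc n))) = (\<Sum>n. b (Suc n) * (3 / 6 ^ Suc n) / 6)"
      by (intro suminf_cong) simp
    moreover have "\<dots> = (\<Sum>n. b (Suc n) * (3 / 6 ^ Suc n)) / 6"
      using b by (intro suminf_divide sm) auto
    ultimately show ?thesis by simp
  qed
  show "0 \<le> t" "t \<le> 3 / 5" unfolding t_def using tail[of a, OF a] by auto
  fix n
  (* Shifting by n places splits off an integer. *)
  have head: "\<exists>j::int. 6 ^ n * (\<Sum>i. b i * (3 / 6 ^ Suc i)) = of_int j + (\<Sum>i. b (i + n) * (3 / 6 ^ Suc i))"
    if "\<And>i. b i \<in> {0, 1}" for b :: "nat \<Rightarrow> real"
    using that
  proof (induction n arbitrary: b)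
    case 0
    show ?case by (intro exI[of _ 0]) simp
  next
    case (Suc n)
    let ?b = "\<lambda>i. b (Suc i)"
    obtain j :: int where j: "6 ^ n * (\<Sum>i. ?b i * (3 / 6 ^ Suc i)) = of_int j + (\<Sum>i. ?b (i + n) * (3 / 6 ^ Suc i))"
      using Suc.IH[of ?b] Suc.prems by blast
    have "6 ^ Suc n * (\<Sum>i. b i * (3 / 6 ^ Suc i)) = 6 ^ n * (\<Sum>i. ?b i * (3 / 6 ^ Suc i)) + 6 ^ n * (3 * b 0)"
      unfolding first_digit[of b, OF Suc.prems] by (simp add: algebra_simps)
    moreover obtain c :: int where "b 0 = of_int c" using Suc.prems[of 0] by (metis insert_iff of_int_0 of_int_1 singletonD)
    ultimately have "6 ^ Suc n * (\<Sum>i. b i * (3 / 6 ^ Suc i)) = of_int (j + 6 ^ n * (3 * c)) + (\<Sum>i. b (i + Suc n) * (3 / 6 ^ Suc i))"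
      using j by simp
    then show ?case by blast
  qed
  obtain j :: int where j: "6 ^ n * t = of_int j + (\<Sum>i. a (i + n) * (3 / 6 ^ Suc i))"
    using head[of a, OF a] unfolding t_def by blast
  let ?c = "\<lambda>i. a (Suc i + n)"
  have "(\<Sum>i. a (i + n) * (3 / 6 ^ Suc i)) = a n / 2 + (\<Sum>i. ?c i * (3 / 6 ^ Suc i)) / 6"
    using first_digit[of "\<lambda>i. a (i + n)"] a by simp
  then have "6 ^ n * (of_int k + t) = of_int (6 ^ n * k + j) + (a n / 2 + (\<Sum>i. ?c i * (3 / 6 ^ Suc i)) / 6)"
    using j by (simp add: algebra_simps)
  then show "digit_reader (6 ^ n * (of_int k + t)) = a n"
    using tail[of ?c] a by (simp only: digit_reader_shift) (intro digit_reader_read, auto)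
qed

text \<open>Interleave the binary digits of the fractional parts of \<open>x\<close> and \<open>y\<close> and use the integer part of
  \<open>x\<close> as integer part of the parameter.  The bound on \<open>X t - t\<close> turns tightness in \<open>x\<close> into tightness
  in \<open>t\<close>.\<close>

lemma space_filling_curve:
  obtains X Y :: "real \<Rightarrow> real" where "continuous_on UNIV X" "continuous_on UNIV Y" "\<And>t. \<bar>X t - t\<bar> \<le> 2"
    "\<And>x y. 0 \<le> y \<Longrightarrow> y < 1 \<Longrightarrow> \<exists>t. X t = x \<and> Y t = y"
proof (rule that[of "\<lambda>t. staircase t + digit_series 0 t" "digit_series 1"])
  show "continuous_on UNIV (\<lambda>t. staircase t + digit_series 0 t)"
    by (intro continuous_intros continuous_staircase continuous_digit_series)
  show "continuous_on UNIV (digit_series 1)" by (rule continuous_digit_series)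
  show "\<bar>staircase t + digit_series 0 t - t\<bar> \<le> 2" for t
    using staircase_bounds[of t] digit_series_bounds[of 0 t] by linarith
  fix x y :: real assume y: "0 \<le> y" "y < 1"
  define bit where "bit z n = real_of_int (\<lfloor>2 ^ Suc n * z\<rfloor> - 2 * \<lfloor>2 ^ n * z\<rfloor>)" for z :: real and n
  have bit: "bit z n \<in> {0, 1}" for z n using binary_digit[of n z] unfolding bit_def by auto
  have bit_sums: "(\<lambda>n. bit z n / 2 ^ Suc n) sums (z - of_int \<lfloor>z\<rfloor>)" for z
    using binary_expansion unfolding bit_def .
  define a where "a n = (if even n then bit x (n div 2) else bit y (n div 2))" for n
  have a: "a n \<in> {0, 1}" for n unfolding a_def using bit by auto
  define t where "t = (\<Sum>n. a n * (3 / 6 ^ Suc n))"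
  note t = expansion_base_6[of a, OF a, folded t_def]
  let ?t = "of_int \<lfloor>x\<rfloor> + t"
  have "staircase ?t = of_int \<lfloor>x\<rfloor>"
  proof -
    have "\<lfloor>?t\<rfloor> = \<lfloor>x\<rfloor>" using t(1,2) by (intro floor_unique) auto
    then show ?thesis using t(2) by (simp add: staircase_def frac_def)
  qed
  moreover have "digit_series 0 ?t = x - of_int \<lfloor>x\<rfloor>"
    unfolding digit_series_def t(3) using sums_unique[OF bit_sums[of x]] by (simp add: a_def)
  moreover have "digit_series 1 ?t = y - of_int \<lfloor>y\<rfloor>"
    unfolding digit_series_def t(3) using sums_unique[OF bit_sums[of y]] by (simp add: a_def)
  moreover have "\<lfloor>y\<rfloor> = 0" using y by (simp add: floor_eq_iff)
  ultimately show "\<exists>t. staircase t + digit_series 0 t = x \<and> digit_series 1 t = y"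
    by (intro exI[of _ ?t]) simp
qed

section \<open>Moments under weak convergence\<close>

definition truncate :: "real \<Rightarrow> real \<Rightarrow> real" where
  "truncate K x = max (- K) (min K x)"

lemma abs_truncate_le:
  assumes "0 \<le> K"
  shows "\<bar>truncate K x\<bar> \<le> K" "\<bar>truncate K x\<bar> \<le> \<bar>x\<bar>"
  using assms by (auto simp: truncate_def)

lemma abs_truncate_mono: "0 \<le> K \<Longrightarrow> K \<le> L \<Longrightarrow> \<bar>truncate K x\<bar> \<le> \<bar>truncate L x\<bar>"
  by (auto simp: truncate_def)

lemma truncate_eq: "\<bar>x\<bar> \<le> K \<Longrightarrow> truncate K x = x"
  by (auto simp: truncate_def)

lemma tendsto_truncate: "(\<lambda>n. truncate (real (Suc n)) x) \<longlonglongrightarrow> x"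
proof (rule tendsto_eventually)
  have "\<forall>\<^sub>F n in sequentially. \<bar>x\<bar> \<le> real n" by real_asymp
  then show "\<forall>\<^sub>F n in sequentially. truncate (real (Suc n)) x = x"
    by eventually_elim (simp add: truncate_eq)
qed

text \<open>The error is zero unless \<open>|x| > K\<close>, and then it is at most \<open>|x|\<^sup>m \<le> |x|\<^bsup>2m+2\<^esup> / K\<close>.  The even
  exponent on the right makes the bound integrable by means of moments alone.\<close>

lemma truncate_power_error:
  assumes K: "1 \<le> K"
  shows "\<bar>truncate K x ^ m - x ^ m\<bar> \<le> x ^ (2 * Suc m) / K"
proof (cases "\<bar>x\<bar> \<le> K")
  case True
  have "0 \<le> x ^ (2 * Suc m) / K"
    using K by (intro divide_nonneg_nonneg zero_le_even_power) auto
  then show ?thesis by (simp only: truncate_eq[OF True] diff_self abs_zero)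
next
  case False
  have sgn: "truncate K x = sgn x * K" using False K by (auto simp: truncate_def sgn_if)
  have "truncate K x ^ m - x ^ m = sgn x ^ m * (K ^ m - \<bar>x\<bar> ^ m)"
    unfolding sgn right_diff_distrib power_mult_distrib[symmetric] by (simp add: sgn_mult_abs)
  moreover have "\<bar>sgn x\<bar> = 1" using False K by (auto simp: sgn_if)
  ultimately have "\<bar>truncate K x ^ m - x ^ m\<bar> = \<bar>K ^ m - \<bar>x\<bar> ^ m\<bar>"
    by (simp add: abs_mult power_abs)
  also have "\<dots> \<le> \<bar>x\<bar> ^ m"
    using power_mono[of K "\<bar>x\<bar>" m] False K by (auto simp: abs_if)
  also have "\<dots> \<le> x ^ (2 * Suc m) / K"
  proof -
    have "\<bar>x\<bar> ^ 1 \<le> \<bar>x\<bar> ^ (m + 2)" using False K by (intro power_increasing) auto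
    then have "K \<le> \<bar>x\<bar> ^ (m + 2)" using False by simp
    then have "\<bar>x\<bar> ^ m * K \<le> \<bar>x\<bar> ^ m * \<bar>x\<bar> ^ (m + 2)" by (intro mult_left_mono) auto
    also have "\<dots> = \<bar>x\<bar> ^ (2 * Suc m)" by (simp add: power_add[symmetric] mult_2)
    also have "\<dots> = x ^ (2 * Suc m)" by (simp add: power_even_abs)
    finally show ?thesis using K by (simp add: field_simps)
  qed
  finally show ?thesis .
qed

lemma continuous_truncate:
  assumes "continuous_on UNIV X"
  shows "continuous_on UNIV (\<lambda>t. truncate K (X t))"
  unfolding truncate_def by (intro continuous_intros assms)

text \<open>Truncated moments have bounded continuous integrands, so they converge; the truncation error
  is uniform in the sequence.\<close>

lemma truncated_moment_of_weak_limit: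
  fixes u :: "real \<Rightarrow> 'a :: {banach, second_countable_topology}"
  assumes \<mu>: "\<And>n. real_distribution (\<mu> n)" and M: "real_distribution M" and conv: "weak_conv_m \<mu> M"
    and X: "continuous_on UNIV X" and u: "continuous_on UNIV u" "\<And>t. norm (u t) \<le> 1"
    and int: "\<And>n m. integrable (\<mu> n) (\<lambda>t. X t ^ m)"
    and S: "(\<lambda>n. \<integral>t. X t ^ (2 * Suc m) \<partial>\<mu> n) \<longlonglongrightarrow> S"
    and L: "(\<lambda>n. \<integral>t. X t ^ m *\<^sub>R u t \<partial>\<mu> n) \<longlonglongrightarrow> L"
    and K: "1 \<le> K"
  shows "norm ((\<integral>t. truncate K (X t) ^ m *\<^sub>R u t \<partial>M) - L) \<le> S / K"
proof -
  interpret \<mu>: real_distribution "\<mu> n" for n by (rule \<mu>)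
  have mX: "X \<in> borel_measurable (\<mu> n)" and mu: "u \<in> borel_measurable (\<mu> n)" for n
    using X u(1) by (auto intro: borel_measurable_continuous_onI simp: measurable_cong_sets[OF \<mu>.events_eq_borel refl])
  let ?g = "\<lambda>t. truncate K (X t) ^ m *\<^sub>R u t"
  have cont: "continuous_on UNIV ?g"
    by (intro continuous_intros continuous_truncate X u)
  have bound: "norm (?g t) \<le> K ^ m" for t
  proof -
    have "\<bar>truncate K (X t)\<bar> ^ m * norm (u t) \<le> K ^ m * 1"
      using K u(2) by (intro mult_mono power_mono abs_truncate_le) auto
    then show ?thesis by (simp add: power_abs)
  qed
  have "(\<lambda>n. \<integral>t. ?g t \<partial>\<mu> n) \<longlonglongrightarrow> (\<integral>t. ?g t \<partial>M)"
    using cont bound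
    by (intro weak_conv_imp_integral_bdd_continuous_conv \<mu> M conv) (auto simp: continuous_on_eq_continuous_at)
  from tendsto_norm[OF tendsto_diff[OF this L]]
  have lim: "(\<lambda>n. norm ((\<integral>t. ?g t \<partial>\<mu> n) - (\<integral>t. X t ^ m *\<^sub>R u t \<partial>\<mu> n))) \<longlonglongrightarrow> norm ((\<integral>t. ?g t \<partial>M) - L)" .
  have "norm ((\<integral>t. ?g t \<partial>\<mu> n) - (\<integral>t. X t ^ m *\<^sub>R u t \<partial>\<mu> n)) \<le> (\<integral>t. X t ^ (2 * Suc m) \<partial>\<mu> n) / K" for n
  proof -
    have i1: "integrable (\<mu> n) ?g"
      using bound cont
      by (intro \<mu>.integrable_const_bound[where B = "K ^ m"])
         (auto intro: borel_measurable_continuous_onI simp: measurable_cong_sets[OF \<mu>.events_eq_borel refl])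
    have i2: "integrable (\<mu> n) (\<lambda>t. X t ^ m *\<^sub>R u t)"
      using mX mu u(2)
      by (intro Bochner_Integration.integrable_bound[OF int[of n m]]) (auto intro!: mult_left_le)
    have i3: "integrable (\<mu> n) (\<lambda>t. X t ^ (2 * Suc m) / K)" by (intro integrable_divide int)
    have "(\<integral>t. ?g t \<partial>\<mu> n) - (\<integral>t. X t ^ m *\<^sub>R u t \<partial>\<mu> n) = (\<integral>t. (truncate K (X t) ^ m - X t ^ m) *\<^sub>R u t \<partial>\<mu> n)"
      using i1 i2 by (simp add: scaleR_diff_left)
    also have "norm \<dots> \<le> (\<integral>t. X t ^ (2 * Suc m) / K \<partial>\<mu> n)"
    proof (rule Bochner_Integration.integral_norm_bound_integral[OF _ i3])
      show "integrable (\<mu> n) (\<lambda>t. (truncate K (X t) ^ m - X t ^ m) *\<^sub>R u t)"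
        using i1 i2 by (simp add: scaleR_diff_left)
      fix t
      have "\<bar>truncate K (X t) ^ m - X t ^ m\<bar> * norm (u t) \<le> \<bar>truncate K (X t) ^ m - X t ^ m\<bar> * 1"
        by (intro mult_left_mono u) auto
      also have "\<dots> \<le> X t ^ (2 * Suc m) / K" using truncate_power_error[OF K] by simp
      finally show "norm ((truncate K (X t) ^ m - X t ^ m) *\<^sub>R u t) \<le> X t ^ (2 * Suc m) / K" by simp
    qed
    finally show ?thesis by simp
  qed
  then show ?thesis
    using K by (intro LIMSEQ_le[OF lim tendsto_divide[OF S tendsto_const]]) auto
qed

text \<open>Let the truncation level tend to infinity: monotone convergence first gives integrability of the
  even powers, which then dominate all other integrands.\<close>

lemma moments_of_weak_limit:
  fixes u :: "real \<Rightarrow> complex"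
  assumes \<mu>: "\<And>n. real_distribution (\<mu> n)" and M: "real_distribution M" and conv: "weak_conv_m \<mu> M"
    and X: "continuous_on UNIV X" and u: "continuous_on UNIV u" "\<And>t. norm (u t) \<le> 1"
    and int: "\<And>n m. integrable (\<mu> n) (\<lambda>t. X t ^ m)"
    and S: "\<And>m. (\<lambda>n. \<integral>t. X t ^ (2 * m) \<partial>\<mu> n) \<longlonglongrightarrow> S m"
    and L: "(\<lambda>n. \<integral>t. X t ^ m *\<^sub>R u t \<partial>\<mu> n) \<longlonglongrightarrow> L"
  shows "integrable M (\<lambda>t. X t ^ m *\<^sub>R u t)" "(\<integral>t. X t ^ m *\<^sub>R u t \<partial>M) = L"
proof -
  interpret real_distribution M by (rule M)
  have mX: "X \<in> borel_measurable M" and mu: "u \<in> borel_measurable M"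
    using X u(1) by (auto intro: borel_measurable_continuous_onI simp: measurable_cong_sets[OF events_eq_borel refl])
  have mT: "(\<lambda>t. truncate K (X t)) \<in> borel_measurable M" for K
    unfolding truncate_def using mX by measurable
  let ?K = "\<lambda>j. real (Suc j)"
  have inv0: "(\<lambda>j. a / real (Suc j)) \<longlonglongrightarrow> 0" for a :: real by real_asymp
  have even_lim: "(\<lambda>j. \<integral>t. truncate (?K j) (X t) ^ (2 * m) \<partial>M) \<longlonglongrightarrow> S m"
  proof (rule Lim_null[THEN iffD2], rule Lim_null_comparison[OF _ inv0], intro always_eventually allI)
    fix j
    have "norm ((\<integral>t. truncate (?K j) (X t) ^ (2 * m) *\<^sub>R (1 :: real) \<partial>M) - S m) \<le> S (Suc (2 * m)) / ?K j"
      by (rule truncated_moment_of_weak_limit[OF \<mu> M conv X _ _ int S]) (use S[of m] in auto)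
    then show "norm ((\<integral>t. truncate (?K j) (X t) ^ (2 * m) \<partial>M) - S m) \<le> S (Suc (2 * m)) / ?K j" by simp
  qed
  have even_int: "integrable M (\<lambda>t. X t ^ (2 * m))"
  proof (rule integral_monotone_convergence_nonneg(1)[OF _ _ _ _ even_lim])
    fix j
    have "norm (truncate (?K j) (X t) ^ (2 * m)) \<le> ?K j ^ (2 * m)" for t
      unfolding norm_power by (intro power_mono) (simp_all add: abs_truncate_le(1))
    then show "integrable M (\<lambda>t. truncate (?K j) (X t) ^ (2 * m))"
      using mT by (intro integrable_const_bound[where B = "?K j ^ (2 * m)"]) auto
  next
    show "AE t in M. mono (\<lambda>j. truncate (?K j) (X t) ^ (2 * m))"
    proof (intro always_eventually allI monoI)
      fix t and i j :: nat assume "i \<le> j"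
      then have "\<bar>truncate (?K i) (X t)\<bar> ^ (2 * m) \<le> \<bar>truncate (?K j) (X t)\<bar> ^ (2 * m)"
        by (intro power_mono abs_truncate_mono) auto
      then show "truncate (?K i) (X t) ^ (2 * m) \<le> truncate (?K j) (X t) ^ (2 * m)"
        by (simp add: power_even_abs)
    qed
  next
    show "AE t in M. (\<lambda>j. truncate (?K j) (X t) ^ (2 * m)) \<longlonglongrightarrow> X t ^ (2 * m)"
      by (intro always_eventually allI tendsto_power tendsto_truncate)
  qed (use mX in auto)
  let ?w = "\<lambda>t. X t ^ (2 * m) + 1"
  have w: "integrable M ?w" using even_int by simp
  have power_le: "\<bar>x\<bar> ^ m \<le> x ^ (2 * m) + 1" for x :: real
  proof -
    have "0 \<le> (\<bar>x\<bar> ^ m - 1)\<^sup>2 + (\<bar>x\<bar> ^ m)\<^sup>2 + 1" by simp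
    also have "\<dots> = 2 * ((\<bar>x\<bar> ^ m)\<^sup>2 + 1 - \<bar>x\<bar> ^ m)" by (simp add: power2_eq_square algebra_simps)
    also have "(\<bar>x\<bar> ^ m)\<^sup>2 = \<bar>x\<bar> ^ (2 * m)" by (simp only: power_mult[symmetric] mult.commute)
    also have "\<dots> = x ^ (2 * m)" by (simp add: power_even_abs)
    finally show ?thesis by simp
  qed
  have le_w: "norm (c ^ m *\<^sub>R u t) \<le> ?w t" if "\<bar>c\<bar> \<le> \<bar>X t\<bar>" for c t
  proof -
    have "\<bar>c\<bar> ^ m * norm (u t) \<le> \<bar>X t\<bar> ^ m * 1"
      using that u(2) by (intro mult_mono power_mono) auto
    then show ?thesis using power_le[of "X t"] by (simp add: power_abs)
  qed
  show "integrable M (\<lambda>t. X t ^ m *\<^sub>R u t)"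
    using le_w mX mu by (intro Bochner_Integration.integrable_bound[OF w]) (auto intro: order.trans[OF _ abs_ge_self])
  have "(\<lambda>j. \<integral>t. truncate (?K j) (X t) ^ m *\<^sub>R u t \<partial>M) \<longlonglongrightarrow> (\<integral>t. X t ^ m *\<^sub>R u t \<partial>M)"
  proof (rule integral_dominated_convergence[OF _ _ w])
    show "AE t in M. (\<lambda>j. truncate (?K j) (X t) ^ m *\<^sub>R u t) \<longlonglongrightarrow> X t ^ m *\<^sub>R u t"
      by (intro always_eventually allI tendsto_intros tendsto_truncate)
    show "AE t in M. norm (truncate (?K j) (X t) ^ m *\<^sub>R u t) \<le> ?w t" for j
      by (intro always_eventually allI le_w abs_truncate_le(2)) simp
  qed (use mX mT mu in auto)
  moreover have "(\<lambda>j. \<integral>t. truncate (?K j) (X t) ^ m *\<^sub>R u t \<partial>M) \<longlonglongrightarrow> L"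
  proof (rule Lim_null[THEN iffD2], rule Lim_null_comparison[OF _ inv0], intro always_eventually allI)
    fix j
    show "norm ((\<integral>t. truncate (?K j) (X t) ^ m *\<^sub>R u t \<partial>M) - L) \<le> S (Suc m) / ?K j"
      by (rule truncated_moment_of_weak_limit[OF \<mu> M conv X u int S L]) simp
  qed
  ultimately show "(\<integral>t. X t ^ m *\<^sub>R u t \<partial>M) = L" by (rule LIMSEQ_unique)
qed

text \<open>Markov's inequality for \<open>X\<^sup>2\<close>, transferred from \<open>X\<close> to the parameter.\<close>

lemma tight_if_second_moment_bounded:
  assumes \<mu>: "\<And>n. real_distribution (\<mu> n)" and X: "continuous_on UNIV X" "\<And>t. \<bar>X t - t\<bar> \<le> C"
    and int: "\<And>n. integrable (\<mu> n) (\<lambda>t. (X t)\<^sup>2)" and B: "\<And>n. (\<integral>t. (X t)\<^sup>2 \<partial>\<mu> n) \<le> B"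
  shows "tight \<mu>"
  unfolding tight_def
proof (intro conjI allI impI \<mu>)
  fix \<epsilon> :: real assume \<epsilon>: "0 < \<epsilon>"
  interpret \<mu>: real_distribution "\<mu> n" for n by (rule \<mu>)
  have "0 \<le> (\<integral>t. (X t)\<^sup>2 \<partial>\<mu> 0)" by simp
  then have B0: "0 \<le> B" using B[of 0] by linarith
  define R where "R = B / \<epsilon> + 1"
  have R: "1 \<le> R" using B0 \<epsilon> by (simp add: R_def)
  have "B < \<epsilon> * R" using \<epsilon> by (simp add: R_def field_simps)
  also have "\<epsilon> * R \<le> \<epsilon> * R\<^sup>2" using R \<epsilon> by (simp add: power2_eq_square)
  finally have BR: "B / R\<^sup>2 < \<epsilon>" using R by (simp add: field_simps)
  have C: "0 \<le> C" using X(2)[of 0] by linarith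
  let ?I = "{- (R + C)<..R + C}"
  have "1 - \<epsilon> < measure (\<mu> n) ?I" for n
  proof -
    let ?A = "{t \<in> space (\<mu> n). R\<^sup>2 \<le> (X t)\<^sup>2}"
    have mX: "X \<in> borel_measurable (\<mu> n)"
      using X by (auto intro: borel_measurable_continuous_onI simp: measurable_cong_sets[OF \<mu>.events_eq_borel refl])
    have "measure (\<mu> n) ?A \<le> (\<integral>t. (X t)\<^sup>2 \<partial>\<mu> n) / R\<^sup>2"
      using R by (intro integral_Markov_inequality_measure[where A = "{}"] int) auto
    also have "\<dots> \<le> B / R\<^sup>2" using R by (intro divide_right_mono B) auto
    finally have A: "measure (\<mu> n) ?A < \<epsilon>" using BR by simp
    have "space (\<mu> n) - ?I \<subseteq> ?A"
    proof
      fix t assume "t \<in> space (\<mu> n) - ?I"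
      then have t: "t \<le> - (R + C) \<or> R + C < t" by auto
      then have "R \<le> \<bar>X t\<bar>" using X(2)[of t] R C by auto
      then have "R\<^sup>2 \<le> (X t)\<^sup>2" using R by (metis abs_le_square_iff abs_of_nonneg order.trans zero_le_one)
      then show "t \<in> ?A" by simp
    qed
    then have "measure (\<mu> n) (space (\<mu> n) - ?I) \<le> measure (\<mu> n) ?A"
      using mX by (intro \<mu>.finite_measure_mono) auto
    then show ?thesis using A \<mu>.prob_compl[of ?I n] by simp
  qed
  moreover have "- (R + C) < R + C" using R C by simp
  ultimately show "\<exists>a b. a < b \<and> (\<forall>n. 1 - \<epsilon> < measure (\<mu> n) {a<..b})" by blast
qed

definition atomic_distribution :: "'i set \<Rightarrow> ('i \<Rightarrow> real) \<Rightarrow> ('i \<Rightarrow> real) \<Rightarrow> real measure" where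
  "atomic_distribution I w t = distr (point_measure I (\<lambda>i. ennreal (w i))) borel t"

lemma atomic_distribution:
  fixes g :: "real \<Rightarrow> 'a :: {banach, second_countable_topology}"
  assumes "finite I" "\<And>i. i \<in> I \<Longrightarrow> 0 \<le> w i"
  shows real_distribution_atomic: "sum w I = 1 \<Longrightarrow> real_distribution (atomic_distribution I w t)"
    and integrable_atomic: "g \<in> borel_measurable borel \<Longrightarrow> integrable (atomic_distribution I w t) g"
    and integral_atomic: "g \<in> borel_measurable borel \<Longrightarrow>
      integral\<^sup>L (atomic_distribution I w t) g = (\<Sum>i\<in>I. w i *\<^sub>R g (t i))"
proof -
  let ?P = "point_measure I (\<lambda>i. ennreal (w i))"
  have t: "t \<in> borel_measurable ?P" by (simp add: point_measure_def)
  show "real_distribution (atomic_distribution I w t)" if "sum w I = 1"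
  proof -
    have "emeasure ?P (space ?P) = 1"
      using assms that by (simp add: space_point_measure emeasure_point_measure_finite sum_ennreal)
    then have "prob_space ?P" by (rule prob_spaceI)
    then have "prob_space (atomic_distribution I w t)"
      unfolding atomic_distribution_def using t by (rule prob_space.prob_space_distr)
    then show ?thesis
      by (simp add: real_distribution_def real_distribution_axioms_def atomic_distribution_def)
  qed
  assume g: "g \<in> borel_measurable borel"
  show "integrable (atomic_distribution I w t) g"
    unfolding atomic_distribution_def using t g assms
    by (simp add: integrable_distr_eq integrable_point_measure_finite)
  show "integral\<^sup>L (atomic_distribution I w t) g = (\<Sum>i\<in>I. w i *\<^sub>R g (t i))"
    unfolding atomic_distribution_def using t g assms
    by (simp add: integral_distr lebesgue_integral_point_measure_finite)
qed

section \<open>The Devinatz moment problem\<close>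

text \<open>The solution before it is moved to the strip and rescaled to total mass \<open>c\<close>.  An atomic
  measure is lifted by choosing a preimage under the curve for each of its finitely many atoms.\<close>

lemma moment_measure_on_line:
  assumes s: "devinatz_positive s" and c: "s 0 0 = complex_of_real c" "0 < c"
    and X: "continuous_on UNIV X" "\<And>t. \<bar>X t - t\<bar> \<le> C" and Y: "continuous_on UNIV Y"
    and onto: "\<And>x y. 0 \<le> y \<Longrightarrow> y < 1 \<Longrightarrow> \<exists>t. X t = x \<and> Y t = y"
  obtains M where "real_distribution M"
    "\<And>m k. integrable M (\<lambda>t. X t ^ m *\<^sub>R cis (2 * pi * of_int k * Y t))"
    "\<And>m k. (\<integral>t. X t ^ m *\<^sub>R cis (2 * pi * of_int k * Y t) \<partial>M) = s m k / c"
proof -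
  let ?e = "\<lambda>k t. cis (2 * pi * of_int k * Y t)"
  let ?f = "\<lambda>N k. 1 - \<bar>real_of_int k\<bar> / real (Suc N)"
  have e_cont: "continuous_on UNIV (?e k)" for k
    by (intro continuous_on_cis continuous_intros Y)
  define approx where "approx N \<mu> \<longleftrightarrow> real_distribution \<mu> \<and> (\<forall>m. integrable \<mu> (\<lambda>t. X t ^ m)) \<and>
    (\<forall>m k. m \<le> N \<longrightarrow> \<bar>k\<bar> \<le> int N \<longrightarrow> (\<integral>t. X t ^ m *\<^sub>R ?e k t \<partial>\<mu>) = ?f N k *\<^sub>R (s m k / c))" for N \<mu>
  have "\<exists>\<mu>. approx N \<mu>" for N
  proof -
    obtain I w \<theta> where I: "finite (I :: (nat \<times> real) set)" "\<And>i. 0 \<le> w i" "\<And>i. i \<in> I \<Longrightarrow> 0 \<le> \<theta> i \<and> \<theta> i < 1"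
      and moments: "\<And>m k. m \<le> N \<Longrightarrow> \<bar>k\<bar> \<le> int N \<Longrightarrow>
       (\<Sum>i\<in>I. w i *\<^sub>R (complex_of_real (snd i) ^ m * cis (2 * pi * of_int k * \<theta> i))) = ?f N k *\<^sub>R s m k"
      by (rule fejer_atomic_measures[OF s, of N]) blast
    have "\<forall>i\<in>I. \<exists>t. X t = snd i \<and> Y t = \<theta> i" using I(3) onto by blast
    then obtain t where t: "\<And>i. i \<in> I \<Longrightarrow> X (t i) = snd i \<and> Y (t i) = \<theta> i" by metis
    define v where "v i = w i / c" for i
    have v: "0 \<le> v i" for i using I(2) c(2) by (simp add: v_def)
    have "complex_of_real (sum w I) = complex_of_real c"
      using moments[of 0 0] c(1) by (simp add: scaleR_conv_of_real)
    then have "sum w I = c" by (simp only: of_real_eq_iff)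
    then have "sum v I = 1" using c(2) by (simp add: v_def sum_divide_distrib[symmetric])
    define \<mu> where "\<mu> = atomic_distribution I v t"
    have "real_distribution \<mu>" unfolding \<mu>_def
      by (rule real_distribution_atomic[OF I(1) v \<open>sum v I = 1\<close>])
    moreover have "integrable \<mu> (\<lambda>t. X t ^ m)" for m unfolding \<mu>_def
      by (intro integrable_atomic I(1) v borel_measurable_continuous_onI continuous_intros X)
    moreover have "(\<integral>t. X t ^ m *\<^sub>R ?e k t \<partial>\<mu>) = ?f N k *\<^sub>R (s m k / c)" if "m \<le> N" "\<bar>k\<bar> \<le> int N" for m k
    proof -
      have "(\<integral>t. X t ^ m *\<^sub>R ?e k t \<partial>\<mu>) = (\<Sum>i\<in>I. v i *\<^sub>R (X (t i) ^ m *\<^sub>R ?e k (t i)))"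
        unfolding \<mu>_def by (intro integral_atomic I(1) v borel_measurable_continuous_onI continuous_intros X e_cont)
      also have "\<dots> = (\<Sum>i\<in>I. w i *\<^sub>R (complex_of_real (snd i) ^ m * cis (2 * pi * of_int k * \<theta> i))) / c"
        unfolding sum_divide_distrib using t
        by (intro sum.cong refl) (simp add: v_def scaleR_conv_of_real)
      also have "\<dots> = ?f N k *\<^sub>R (s m k / c)" unfolding moments[OF that] by (simp only: scaleR_conv_of_real times_divide_eq_right)
      finally show ?thesis .
    qed
    ultimately show ?thesis unfolding approx_def by blast
  qed
  then obtain \<mu> where approx: "\<And>N. approx N (\<mu> N)" by metis
  have \<mu>: "\<And>N. real_distribution (\<mu> N)"
    and int: "\<And>N m. integrable (\<mu> N) (\<lambda>t. X t ^ m)"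
    and mom: "\<And>N m k. m \<le> N \<Longrightarrow> \<bar>k\<bar> \<le> int N \<Longrightarrow> (\<integral>t. X t ^ m *\<^sub>R ?e k t \<partial>\<mu> N) = ?f N k *\<^sub>R (s m k / c)"
    using approx unfolding approx_def by auto
  have lim: "(\<lambda>N. \<integral>t. X t ^ m *\<^sub>R ?e k t \<partial>\<mu> N) \<longlonglongrightarrow> s m k / c" for m k
  proof -
    have "(\<lambda>N. ?f N k) \<longlonglongrightarrow> 1" by real_asymp
    then have "(\<lambda>N. ?f N k *\<^sub>R (s m k / c)) \<longlonglongrightarrow> 1 *\<^sub>R (s m k / c)" by (intro tendsto_scaleR tendsto_const)
    moreover have "\<forall>\<^sub>F N in sequentially. ?f N k *\<^sub>R (s m k / c) = (\<integral>t. X t ^ m *\<^sub>R ?e k t \<partial>\<mu> N)"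
      using eventually_ge_at_top[of "max m (nat \<bar>k\<bar>)"] by eventually_elim (rule mom[symmetric]; linarith)
    ultimately show ?thesis by (simp add: tendsto_cong)
  qed
  have real_mom: "(\<integral>t. X t ^ m *\<^sub>R ?e 0 t \<partial>\<mu> N) = complex_of_real (\<integral>t. X t ^ m \<partial>\<mu> N)" for m N
    by (simp add: scaleR_conv_of_real integral_complex_of_real flip: of_real_power)
  have real_lim: "(\<lambda>N. \<integral>t. X t ^ m \<partial>\<mu> N) \<longlonglongrightarrow> Re (s m 0 / c)" for m
    using tendsto_Re[OF lim[of m 0]] unfolding real_mom by simp
  have second: "(\<integral>t. (X t)\<^sup>2 \<partial>\<mu> (N + 2)) = Re (s 2 0 / c)" for N
    using arg_cong[OF mom[of 2 "N + 2" 0], of Re] unfolding real_mom by simp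
  (* The second moment is the prescribed one from index 2 on. *)
  have "tight (\<lambda>N. \<mu> (N + 2))"
    by (rule tight_if_second_moment_bounded[OF \<mu> X int eq_refl[OF second]])
  from tight_imp_convergent_subsubsequence[OF this strict_mono_id] obtain r M where
    r: "strict_mono r" and M: "real_distribution M" and conv: "weak_conv_m ((\<lambda>N. \<mu> (N + 2)) \<circ> id \<circ> r) M"
    by blast
  have r': "strict_mono (\<lambda>n. r n + 2)" using r by (auto simp: strict_mono_def)
  have conv: "weak_conv_m (\<lambda>n. \<mu> (r n + 2)) M" using conv by (simp add: comp_def)
  have sub_lim: "(\<lambda>n. \<integral>t. X t ^ m *\<^sub>R ?e k t \<partial>\<mu> (r n + 2)) \<longlonglongrightarrow> s m k / c" for m k
    using LIMSEQ_subseq_LIMSEQ[OF lim r'] by (simp add: comp_def)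
  have sub_real_lim: "(\<lambda>n. \<integral>t. X t ^ (2 * m) \<partial>\<mu> (r n + 2)) \<longlonglongrightarrow> Re (s (2 * m) 0 / c)" for m
    using LIMSEQ_subseq_LIMSEQ[OF real_lim r'] by (simp add: comp_def)
  have unit: "norm (?e k t) \<le> 1" for k t by simp
  note limit = moments_of_weak_limit[OF \<mu> M conv X(1) e_cont unit int sub_real_lim sub_lim]
  show thesis by (rule that[OF M limit])
qed

text \<open>If \<open>s 0 0\<close> vanishes, so do all weights of the approximating atomic measures, and hence \<open>s\<close>
  itself.  Otherwise the measure on the line is normalised, scaled back by its density and mapped to the strip;
  the angle, given there in full turns, is reduced to the interval from \<open>-\<pi>\<close> to \<open>\<pi>\<close>.\<close>

lemma solution_of_positive:
  assumes s: "devinatz_positive s"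
  shows "\<exists>\<mu>. devinatz_solution s \<mu>"
proof -
  have "0 \<le> s 0 0" using devinatz_positive_sum[OF s, of "{(0, 0)}" "\<lambda>_ _. 1"] by simp
  then obtain c where c: "s 0 0 = complex_of_real c" "0 \<le> c"
    by (intro that[of "Re (s 0 0)"]) (auto simp: less_eq_complex_def complex_eq_iff)
  let ?g = "\<lambda>m n. \<lambda>(x, \<phi>). complex_of_real x ^ m * exp (\<i> * of_int n * complex_of_real \<phi>)"
  have g: "?g m n \<in> borel_measurable (restrict_space borel strip)" for m n
    by (intro measurable_restrict_space1 borel_measurable_continuous_onI)
       (auto simp: case_prod_beta intro!: continuous_intros)
  show ?thesis
  proof (cases "c = 0")
    case True
    have "s m k = 0" for m k
    proof -
      define N where "N = m + nat \<bar>k\<bar>"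
      obtain I w \<theta> where I: "finite (I :: (nat \<times> real) set)" "\<And>i. 0 \<le> w i"
        and moments: "\<And>m k. m \<le> N \<Longrightarrow> \<bar>k\<bar> \<le> int N \<Longrightarrow>
         (\<Sum>i\<in>I. w i *\<^sub>R (complex_of_real (snd i) ^ m * cis (2 * pi * of_int k * \<theta> i)))
          = (1 - \<bar>of_int k\<bar> / real (Suc N)) *\<^sub>R s m k"
        by (rule fejer_atomic_measures[OF s, of N]) blast
      have "complex_of_real (sum w I) = 0"
        using moments[of 0 0] c True by (simp add: scaleR_conv_of_real)
      then have "w i = 0" if "i \<in> I" for i
        using that I by (simp only: of_real_eq_0_iff sum_nonneg_eq_0_iff)
      then have "(1 - \<bar>of_int k\<bar> / real (Suc N)) *\<^sub>R s m k = 0"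
        using moments[of m k] by (simp add: N_def)
      moreover have "\<bar>of_int k\<bar> / real (Suc N) < 1" by (simp add: N_def)
      ultimately show ?thesis by simp
    qed
    then have "devinatz_solution s (null_measure (restrict_space borel strip))"
      using g by (simp add: devinatz_solution_def)
    then show ?thesis by blast
  next
    case False
    with c have "0 < c" by simp
    obtain X Y :: "real \<Rightarrow> real" where XY: "continuous_on UNIV X" "continuous_on UNIV Y" "\<And>t. \<bar>X t - t\<bar> \<le> 2"
      "\<And>x y. 0 \<le> y \<Longrightarrow> y < 1 \<Longrightarrow> \<exists>t. X t = x \<and> Y t = y"
      by (rule space_filling_curve) blast
    obtain M where M: "real_distribution M"
      and int: "\<And>m k. integrable M (\<lambda>t. X t ^ m *\<^sub>R cis (2 * pi * of_int k * Y t))"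
      and mom: "\<And>m k. (\<integral>t. X t ^ m *\<^sub>R cis (2 * pi * of_int k * Y t) \<partial>M) = s m k / c"
    proof (rule moment_measure_on_line[OF s c(1) \<open>0 < c\<close> XY(1,3,2)])
      show "\<exists>t. X t = x \<and> Y t = y" if "0 \<le> y" "y < 1" for x y using that by (rule XY(4))
    qed blast
    interpret real_distribution M by (rule M)
    have mX [measurable]: "X \<in> borel_measurable M" and mY [measurable]: "Y \<in> borel_measurable M"
      using XY by (auto intro: borel_measurable_continuous_onI simp: measurable_cong_sets[OF events_eq_borel refl])
    (* Rounding to the nearest integer instead of rounding down centres the interval at 0. *)
    define \<psi> where "\<psi> t = 2 * pi * (Y t - of_int \<lfloor>Y t + 1 / 2\<rfloor>)" for t
    define T where "T t = (X t, \<psi> t)" for t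
    have "\<psi> t \<in> {-pi..<pi}" for t
    proof -
      have "- (1 / 2) \<le> Y t - of_int \<lfloor>Y t + 1 / 2\<rfloor>" "Y t - of_int \<lfloor>Y t + 1 / 2\<rfloor> < 1 / 2" by linarith+
      then have "2 * pi * - (1 / 2) \<le> \<psi> t" "\<psi> t < 2 * pi * (1 / 2)"
        unfolding \<psi>_def by (intro mult_left_mono mult_strict_left_mono; simp)+
      then show ?thesis by simp
    qed
    then have T_strip: "T t \<in> strip" for t by (simp add: T_def strip_def)
    have "T \<in> borel_measurable M" unfolding T_def \<psi>_def by measurable
    then have T: "T \<in> M \<rightarrow>\<^sub>M restrict_space borel strip"
      by (intro measurable_restrict_space2) (auto simp: T_strip)
    define D where "D = density M (\<lambda>_. ennreal c)"
    have T': "T \<in> D \<rightarrow>\<^sub>M restrict_space borel strip" using T by (simp add: D_def)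
    have gT: "?g m n (T t) = X t ^ m *\<^sub>R cis (2 * pi * of_int n * Y t)" for m n t
    proof -
      have "exp (\<i> * of_int n * complex_of_real (\<psi> t)) = cis (of_int n * \<psi> t)"
        by (simp add: cis_conv_exp mult_ac)
      also have "of_int n * \<psi> t = 2 * pi * of_int n * Y t + 2 * pi * of_int (- n * \<lfloor>Y t + 1 / 2\<rfloor>)"
        by (simp add: \<psi>_def algebra_simps)
      also have "cis \<dots> = cis (2 * pi * of_int n * Y t)"
        unfolding cis_mult[symmetric] by (subst cis_multiple_2pi) auto
      finally show ?thesis by (simp add: T_def scaleR_conv_of_real)
    qed
    have "devinatz_solution s (distr D (restrict_space borel strip) T)"
      unfolding devinatz_solution_def
    proof (intro conjI allI)
      fix m n
      have "integrable D (\<lambda>t. ?g m n (T t))"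
        unfolding gT D_def using int[of m n] \<open>0 < c\<close> by (subst integrable_density) (auto simp del: scaleR_scaleR)
      then show "integrable (distr D (restrict_space borel strip) T) (?g m n)"
        by (subst integrable_distr_eq[OF T' g])
      have "integral\<^sup>L (distr D (restrict_space borel strip) T) (?g m n) = (\<integral>t. ?g m n (T t) \<partial>D)"
        by (rule integral_distr[OF T' g])
      also have "\<dots> = (\<integral>t. c *\<^sub>R (X t ^ m *\<^sub>R cis (2 * pi * of_int n * Y t)) \<partial>M)"
        unfolding gT D_def using int[of m n] \<open>0 < c\<close> by (subst integral_density) (auto simp del: scaleR_scaleR)
      also have "\<dots> = s m n"
        using mom[of m n] \<open>0 < c\<close> by (simp add: scaleR_conv_of_real)
      finally show "integral\<^sup>L (distr D (restrict_space borel strip) T) (?g m n) = s m n" .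
    qed simp
    then show ?thesis by blast
  qed
qed

text \<open>The form is the integral of the squared modulus of a trigonometric polynomial in \<open>\<phi>\<close> with
  polynomial coefficients in \<open>x\<close>.\<close>

lemma positive_of_solution:
  assumes "devinatz_solution s \<mu>"
  shows "devinatz_positive s"
  unfolding devinatz_positive_def
proof (intro allI impI)
  fix \<alpha> :: "nat \<Rightarrow> int \<Rightarrow> complex"
  let ?S = "{(m, n). \<alpha> m n \<noteq> 0}"
  assume fin: "finite ?S"
  define e where "e m n z = complex_of_real (fst z) ^ m * exp (\<i> * of_int n * complex_of_real (snd z))"
    for m n and z :: "real \<times> real"
  have int: "integrable \<mu> (e m n)" and mom: "integral\<^sup>L \<mu> (e m n) = s m n" for m n
  proof -
    have "e m n = (\<lambda>(x, \<phi>). complex_of_real x ^ m * exp (\<i> * of_int n * complex_of_real \<phi>))"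
      by (auto simp: e_def)
    then show "integrable \<mu> (e m n)" "integral\<^sup>L \<mu> (e m n) = s m n"
      using assms unfolding devinatz_solution_def by simp_all
  qed
  have e_mult: "e m n z * cnj (e k l z) = e (m + k) (n - l) z" for m n k l z
    by (simp add: e_def power_add exp_cnj exp_minus algebra_simps exp_diff divide_inverse)
  define p where "p z = (\<Sum>(m, n)\<in>?S. \<alpha> m n * e m n z)" for z
  have "(\<Sum>(m, n)\<in>?S. \<Sum>(k, l)\<in>?S. \<alpha> m n * cnj (\<alpha> k l) * s (m + k) (n - l))
      = (\<Sum>i\<in>?S. \<Sum>j\<in>?S. \<integral>z. \<alpha> (fst i) (snd i) * cnj (\<alpha> (fst j) (snd j)) * e (fst i + fst j) (snd i - snd j) z \<partial>\<mu>)"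
    by (simp add: case_prod_beta mom)
  also have "\<dots> = (\<integral>z. (\<Sum>i\<in>?S. \<Sum>j\<in>?S. \<alpha> (fst i) (snd i) * cnj (\<alpha> (fst j) (snd j)) * e (fst i + fst j) (snd i - snd j) z) \<partial>\<mu>)"
    by (simp add: int Bochner_Integration.integral_sum)
  also have "\<dots> = (\<integral>z. p z * cnj (p z) \<partial>\<mu>)"
    by (intro Bochner_Integration.integral_cong refl)
       (simp add: p_def case_prod_beta cnj_sum sum_product e_mult[symmetric] mult_ac)
  also have "\<dots> = (\<integral>z. complex_of_real ((cmod (p z))\<^sup>2) \<partial>\<mu>)"
    by (simp only: complex_norm_square)
  also have "\<dots> = complex_of_real (\<integral>z. (cmod (p z))\<^sup>2 \<partial>\<mu>)" by (rule integral_complex_of_real)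
  also have "0 \<le> \<dots>" by (simp add: less_eq_complex_def)
  finally show "0 \<le> (\<Sum>(m, n)\<in>?S. \<Sum>(k, l)\<in>?S. \<alpha> m n * cnj (\<alpha> k l) * s (m + k) (n - l))" .
qed

theorem theorem2p2:
  fixes s :: "nat \<Rightarrow> int \<Rightarrow> complex"
  shows "(\<exists>\<mu>. devinatz_solution s \<mu>) \<longleftrightarrow> devinatz_positive s"
  using positive_of_solution solution_of_positive by blast

end
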